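(* Fix $b>0$ and $\eta\in[0,1)$ satisfying $b^2(1-\eta)<\tfrac12W(2/e)$. If $m=m(n)=(1+o(1))\frac b2n^{3/2}$ as $n\to\infty$, then $$\lim_{n\to\infty}\frac1{n^{3/2}}\log\mathbb P_m\big(X\le\eta\,\mathbb E_mX\big)=-\frac{b^3}{6}\big(1-\eta+\eta\log\eta\big).$$
   Context: $\mathbb P_m$ and $\mathbb E_m$ are probability and expectation for the random graph $G(n,m)$, a uniformly random graph on $n$ labeled vertices with exactly $m$ edges; $X$ is its number of triangles. $W$ is the Lambert-W function, the inverse of $x\mapsto xe^x$ on the nonnegative reals. By convention $\eta\log\eta=0$ when $\eta=0$. *)

theory Defs
  imports "HOL-Probability.Probability" "HOL-Library.Landau_Symbols"
begin

text \<open>A simple graph on the labelled vertices \<open>{..<n}\<close> is given by its edge set.\<close>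

definition edge_slots :: "nat \<Rightarrow> nat set set" where
  "edge_slots n = {e. e \<subseteq> {..<n} \<and> card e = 2}"

definition graphs_with_edges :: "nat \<Rightarrow> nat \<Rightarrow> nat set set set" where
  "graphs_with_edges n m = {E. E \<subseteq> edge_slots n \<and> card E = m}"

text \<open>
  For \<open>m > n choose 2\<close> there is no such graph and \<^const>\<open>pmf_of_set\<close> is unspecified;
  in the sparse regime considered this affects only finitely many \<open>n\<close>.
\<close>

definition random_graph :: "nat \<Rightarrow> nat \<Rightarrow> nat set set pmf" where
  "random_graph n m = pmf_of_set (graphs_with_edges n m)"

definition triangle_count :: "nat \<Rightarrow> nat set set \<Rightarrow> nat" where
  "triangle_count n E =
     card {T. T \<subseteq> {..<n} \<and> card T = 3 \<and> (\<forall>u\<in>T. \<forall>v\<in>T. u \<noteq> v \<longrightarrow> {u, v} \<in> E)}"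

definition lambert_W :: "real \<Rightarrow> real" where
  "lambert_W = the_inv_into {0..} (\<lambda>x. x * exp x)"

lemma strict_mono_on_times_exp: "strict_mono_on {0..} (\<lambda>x::real. x * exp x)"
  by (rule strict_mono_onI) (auto intro!: mult_strict_mono)

lemma bij_betw_times_exp: "bij_betw (\<lambda>x::real. x * exp x) {0..} {0..}"
proof -
  have "y \<in> (\<lambda>x. x * exp x) ` {0..}" if "y \<ge> 0" for y :: real
  proof -
    have "y * 1 \<le> y * exp y"
      using that by (intro mult_left_mono) auto
    then have "\<exists>x\<ge>0. x \<le> y \<and> x * exp x = y"
      using that by (intro IVT') (auto intro!: continuous_intros)
    then show ?thesis
      by auto
  qed
  then show ?thesis
    using strict_mono_on_imp_inj_on[OF strict_mono_on_times_exp]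
    by (auto simp: bij_betw_def)
qed

end

theory Submission
  imports Defs "HOL-Real_Asymp.Real_Asymp"
begin

text \<open>
  Put on all graphs on \<open>n\<close> vertices the Gibbs weight \<open>\<lambda>^|G| (1 - z)^X(G)\<close> with \<open>\<lambda> = c / sqrt n\<close>.
  Occupying a slot replaces the triangles through it by constraints on disjoint pairs of slots;
  adding these one at a time expresses the odds of the slot as a product of factors
  \<open>1 - z P(pair occupied)\<close>. Two triangles share at most one slot, so exploring boundedly many slots
  affects boundedly many triangles at any other slot, and bounds \<open>L\<close> and \<open>U\<close> for
  \<open>sqrt n P(slot occupied)\<close> improve to \<open>c exp (- z U^2)\<close> and \<open>c exp (- z L^2)\<close>.
  With \<open>c = b exp (z b^2)\<close> and \<open>2 z b^2 < 1\<close> this map is a contraction with fixed point \<open>b\<close>.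
  Integrating the edge density gives \<open>log Z ~ (b / 2 + z b^3 / 3) n^(3/2)\<close>.

  Chernoff bounds obtained by varying \<open>b\<close> and \<open>z\<close> show that \<open>|G|\<close> and \<open>X\<close> concentrate at
  \<open>b / 2\<close> and \<open>(1 - z) b^3 / 6\<close> times \<open>n^(3/2)\<close>. Take \<open>z\<close> close to \<open>1 - \<eta>\<close>. Since the probability
  of \<open>X \<le> x\<close> in \<open>G(n,m)\<close> decreases in \<open>m\<close>, it suffices to compare it with its average over a
  window of edge counts slightly above or slightly below \<open>m\<close>, which the Gibbs measure controls.
\<close>

section \<open>Gases with triple constraints\<close>

text \<open>The factors in the odds of a slot are conditional probabilities, given that some slots
  are already decided and that some triangles through occupied slots are not yet charged. A bound at
  the empty state alone therefore cannot be improved; every bound has to hold uniformly over all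
  states with at most \<open>k\<close> decided slots. One improvement decides two more slots beyond
  those of the state, so it consumes two units of \<open>k\<close>. A prescribed accuracy takes
  finitely many improvements, hence \<open>k\<close> never has to grow with \<open>n\<close>. The
  obstacle is \<open>z = 1\<close>, the value that belongs to \<eta> = 0: a completed triangle then
  has weight 0, and a slot that would complete one together with two occupied slots has no positive
  lower bound. Such slots are excluded from the lower bounds; there are at most k^2 of them. The
  improvement map is decreasing, so lower bounds turn into upper bounds and back; the contraction is
  what makes the two sequences meet.\<close>

definition gas :: "real \<Rightarrow> real \<Rightarrow> ('i \<Rightarrow> 'a set) \<Rightarrow> 'a set \<Rightarrow> 'a set \<Rightarrow> 'i set \<Rightarrow> real" where
  "gas l z s V A H = (\<Sum>S\<in>Pow V. l ^ card S * (1 - z) ^ card {T \<in> H. s T \<subseteq> S \<union> A})"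

lemma gas_nonneg: "0 \<le> l \<Longrightarrow> z \<le> 1 \<Longrightarrow> 0 \<le> gas l z s V A H"
  unfolding gas_def by (intro sum_nonneg mult_nonneg_nonneg zero_le_power) auto

lemma gas_containing:
  assumes "finite V" "B \<subseteq> V"
  shows "(\<Sum>S\<in>{S \<in> Pow V. B \<subseteq> S}. l ^ card S * (1 - z) ^ card {T \<in> H. s T \<subseteq> S \<union> A}) =
    l ^ card B * gas l z s (V - B) (A \<union> B) H"
proof -
  have "(\<Sum>S\<in>{S \<in> Pow V. B \<subseteq> S}. l ^ card S * (1 - z) ^ card {T \<in> H. s T \<subseteq> S \<union> A}) =
    (\<Sum>S\<in>Pow (V - B). l ^ card (B \<union> S) * (1 - z) ^ card {T \<in> H. s T \<subseteq> (B \<union> S) \<union> A})"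
    by (rule sum.reindex_bij_witness[where i = "\<lambda>S. B \<union> S" and j = "\<lambda>S. S - B"])
      (use assms in \<open>auto simp: Un_absorb1\<close>)
  also have "\<dots> = (\<Sum>S\<in>Pow (V - B). l ^ card B *
      (l ^ card S * (1 - z) ^ card {T \<in> H. s T \<subseteq> S \<union> (A \<union> B)}))"
  proof (rule sum.cong[OF refl])
    fix S assume "S \<in> Pow (V - B)"
    then have "card (B \<union> S) = card B + card S"
      using assms by (intro card_Un_disjoint) (auto intro: finite_subset)
    moreover have "B \<union> S \<union> A = S \<union> (A \<union> B)"
      by auto
    ultimately show "l ^ card (B \<union> S) * (1 - z) ^ card {T \<in> H. s T \<subseteq> B \<union> S \<union> A} =
      l ^ card B * (l ^ card S * (1 - z) ^ card {T \<in> H. s T \<subseteq> S \<union> (A \<union> B)})"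
      by (simp add: power_add)
  qed
  finally show ?thesis
    by (simp add: gas_def sum_distrib_left)
qed

lemma gas_split:
  assumes "finite V" "x \<in> V"
  shows "gas l z s V A H = gas l z s (V - {x}) A H + l * gas l z s (V - {x}) (insert x A) H"
proof -
  let ?w = "\<lambda>S. l ^ card S * (1 - z) ^ card {T \<in> H. s T \<subseteq> S \<union> A}"
  have "gas l z s V A H = sum ?w (Pow (V - {x}) \<union> {S \<in> Pow V. {x} \<subseteq> S})"
    unfolding gas_def by (rule sum.cong) (use assms in auto)
  also have "\<dots> = sum ?w (Pow (V - {x})) + sum ?w {S \<in> Pow V. {x} \<subseteq> S}"
    by (rule sum.union_disjoint) (use assms in auto)
  also have "sum ?w {S \<in> Pow V. {x} \<subseteq> S} = l * gas l z s (V - {x}) (insert x A) H"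
    using gas_containing[of V "{x}" l z H s A] assms by simp
  finally show ?thesis
    by (simp add: gas_def)
qed

text \<open>Slots outside \<open>V\<close> and \<open>A\<close> count as vacant, and a triple
  through a vacant slot never completes. So the system with \<open>x\<close> vacant is the system
  with \<open>x\<close> occupied and its triples removed. Putting these triples back one at a time
  yields the odds of \<open>x\<close>.\<close>

lemma gas_occupy_isolated:
  assumes "x \<notin> V" "x \<notin> A"
  shows "gas l z s V (insert x A) {T \<in> H. x \<notin> s T} = gas l z s V A H"
proof -
  have "{T \<in> {T \<in> H. x \<notin> s T}. s T \<subseteq> S \<union> insert x A} = {T \<in> H. s T \<subseteq> S \<union> A}"
    if "S \<in> Pow V" for S
    using that assms by blast
  then show ?thesis
    unfolding gas_def by (intro sum.cong) auto
qed

lemma gas_antimono: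
  assumes "0 \<le> l" "0 \<le> z" "z \<le> 1" "A \<subseteq> B" "finite H"
  shows "gas l z s V B H \<le> gas l z s V A H"
  unfolding gas_def
proof (intro sum_mono mult_left_mono power_decreasing card_mono)
  fix S assume "S \<in> Pow V"
  show "{T \<in> H. s T \<subseteq> S \<union> A} \<subseteq> {T \<in> H. s T \<subseteq> S \<union> B}"
    using assms by auto
qed (use assms in auto)

text \<open>The new triple costs a factor \<open>1 - z\<close> exactly on the configurations that
  complete it, and their mass is again a gas, with the undecided slots of the triple occupied.
  Divided by the old gas, this is the factor \<open>1 - z P(rest of the triple occupied)\<close>. A
  triple with a vacant slot cannot be completed, whence the 0.\<close>

lemma gas_insert_edge:
  assumes "finite V" "finite H" "T \<notin> H"
  shows "gas l z s V A (insert T H) = gas l z s V A H -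
    z * (if s T \<subseteq> V \<union> A then l ^ card (s T - A) * gas l z s (V - (s T - A)) (A \<union> (s T - A)) H else 0)"
proof -
  let ?w = "\<lambda>S. l ^ card S * (1 - z) ^ card {T \<in> H. s T \<subseteq> S \<union> A}"
  have eq: "l ^ card S * (1 - z) ^ card {T' \<in> insert T H. s T' \<subseteq> S \<union> A} =
      ?w S - z * (if s T - A \<subseteq> S then ?w S else 0)" for S
  proof (cases "s T - A \<subseteq> S")
    case True
    then have "{T' \<in> insert T H. s T' \<subseteq> S \<union> A} = insert T {T' \<in> H. s T' \<subseteq> S \<union> A}"
      by auto
    then show ?thesis
      using assms True by (simp add: algebra_simps)
  next
    case False
    then have "{T' \<in> insert T H. s T' \<subseteq> S \<union> A} = {T' \<in> H. s T' \<subseteq> S \<union> A}"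
      by auto
    then show ?thesis
      using False by simp
  qed
  have "gas l z s V A (insert T H) =
      gas l z s V A H - z * (\<Sum>S\<in>Pow V. if s T - A \<subseteq> S then ?w S else 0)"
    unfolding gas_def eq by (simp add: sum_subtractf sum_distrib_left)
  also have "(\<Sum>S\<in>Pow V. if s T - A \<subseteq> S then ?w S else 0) = sum ?w {S \<in> Pow V. s T - A \<subseteq> S}"
    using assms by (subst sum.inter_filter) auto
  also have "\<dots> = (if s T \<subseteq> V \<union> A
      then l ^ card (s T - A) * gas l z s (V - (s T - A)) (A \<union> (s T - A)) H else 0)"
  proof (cases "s T \<subseteq> V \<union> A")
    case True
    then show ?thesis
      using assms by (subst gas_containing) auto
  next
    case False
    then have "{S \<in> Pow V. s T - A \<subseteq> S} = {}"
      by auto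
    then have "sum ?w {S \<in> Pow V. s T - A \<subseteq> S} = 0"
      by (metis (no_types, lifting) sum.empty)
    then show ?thesis
      using False by simp
  qed
  finally show ?thesis .
qed

text \<open>Telescoping over the triples of \<open>F\<close>. The bound on a single factor is
  demanded for every \<open>F'\<close>, because a triple is inserted while an arbitrary part of the
  others is already present.\<close>

lemma gas_edges_le:
  assumes "finite F" and "\<And>T. T \<in> F \<Longrightarrow> 0 \<le> q T"
    and "\<And>F' T. F' \<subseteq> F \<Longrightarrow> T \<in> F - F' \<Longrightarrow>
      gas l z s V A (insert T (H \<union> F')) \<le> q T * gas l z s V A (H \<union> F')"
  shows "gas l z s V A (H \<union> F) \<le> prod q F * gas l z s V A H"
  using assms
proof (induction F rule: finite_induct)
  case (insert T F)
  have "gas l z s V A (insert T (H \<union> F)) \<le> q T * gas l z s V A (H \<union> F)"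
    using insert.hyps by (intro insert.prems(2)) auto
  also have "\<dots> \<le> q T * (prod q F * gas l z s V A H)"
    using insert.prems by (intro mult_left_mono insert.IH) auto
  finally show ?case
    using insert.hyps by (simp add: mult.assoc)
qed auto

lemma gas_edges_ge:
  assumes "finite F" and "\<And>T. T \<in> F \<Longrightarrow> 0 \<le> q T"
    and "\<And>F' T. F' \<subseteq> F \<Longrightarrow> T \<in> F - F' \<Longrightarrow>
      q T * gas l z s V A (H \<union> F') \<le> gas l z s V A (insert T (H \<union> F'))"
  shows "prod q F * gas l z s V A H \<le> gas l z s V A (H \<union> F)"
  using assms
proof (induction F rule: finite_induct)
  case (insert T F)
  have "q T * (prod q F * gas l z s V A H) \<le> q T * gas l z s V A (H \<union> F)"
    using insert.prems by (intro mult_left_mono insert.IH) auto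
  also have "\<dots> \<le> gas l z s V A (insert T (H \<union> F))"
    using insert.hyps by (intro insert.prems(2)) auto
  finally show ?case
    using insert.hyps by (simp add: mult.assoc)
qed auto

lemma card_UN_le_one:
  assumes "finite I" "\<And>i. i \<in> I \<Longrightarrow> card (F i) \<le> 1"
  shows "card (\<Union>i\<in>I. F i) \<le> card I"
proof -
  have "card (\<Union>i\<in>I. F i) \<le> (\<Sum>i\<in>I. card (F i))"
    by (rule card_UN_le[OF assms(1)])
  also have "\<dots> \<le> (\<Sum>i\<in>I. 1)"
    by (rule sum_mono) (use assms in auto)
  finally show ?thesis by simp
qed

section \<open>Linear triple systems and their partially decided states\<close>

locale linear_triple_system =
  fixes \<Omega> :: "'a set" and \<H> :: "'i set" and s :: "'i \<Rightarrow> 'a set" and d :: nat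
  assumes finite_slots: "finite \<Omega>" and finite_triples: "finite \<H>"
    and triple_subset: "T \<in> \<H> \<Longrightarrow> s T \<subseteq> \<Omega>"
    and triple_card: "T \<in> \<H> \<Longrightarrow> card (s T) = 3"
    and linear: "\<lbrakk>T \<in> \<H>; T' \<in> \<H>; x \<in> s T; x \<in> s T'; y \<in> s T; y \<in> s T'; x \<noteq> y\<rbrakk> \<Longrightarrow> T = T'"
    and regular: "x \<in> \<Omega> \<Longrightarrow> card {T \<in> \<H>. x \<in> s T} = d"
begin

text \<open>
  \<open>V\<close> are the undecided slots and \<open>A\<close> the occupied ones; at most \<open>k\<close> slots have been decided.
  Triples may be missing from \<open>H\<close> only if they meet \<open>A\<close>.
\<close>

definition explored :: "nat \<Rightarrow> 'a set \<Rightarrow> 'a set \<Rightarrow> 'i set \<Rightarrow> bool" where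
  "explored k V A H \<longleftrightarrow> V \<subseteq> \<Omega> \<and> A \<subseteq> \<Omega> - V \<and> card (\<Omega> - V) \<le> k \<and> H \<subseteq> \<H> \<and>
     (\<forall>T\<in>\<H> - H. s T \<inter> A \<noteq> {})"

text \<open>Occupying such a slot completes a triple with certainty and costs a factor
  \<open>1 - z\<close>, which may be 0. No uniform positive lower bound on its occupation
  probability is possible.\<close>

definition blocked :: "'a set \<Rightarrow> 'i set \<Rightarrow> 'a set" where
  "blocked A H = {x. \<exists>T\<in>H. x \<in> s T \<and> s T - {x} \<subseteq> A}"

text \<open>Divided by \<open>gas l z s V A H\<close>, the left-hand side is the conditional
  probability that \<open>x\<close> is occupied. Multiplying out avoids asking for a positive
  denominator, and quantifying over all states makes the bound applicable in the middle of an
  exploration.\<close>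

definition occ_le :: "real \<Rightarrow> real \<Rightarrow> nat \<Rightarrow> real \<Rightarrow> bool" where
  "occ_le l z k U \<longleftrightarrow> (\<forall>V A H. explored k V A H \<longrightarrow> (\<forall>x\<in>V.
     l * gas l z s (V - {x}) (insert x A) H \<le> U * gas l z s V A H))"

definition occ_ge :: "real \<Rightarrow> real \<Rightarrow> nat \<Rightarrow> real \<Rightarrow> bool" where
  "occ_ge l z k L \<longleftrightarrow> (\<forall>V A H. explored k V A H \<longrightarrow> (\<forall>x\<in>V - blocked A H.
     L * gas l z s V A H \<le> l * gas l z s (V - {x}) (insert x A) H))"

lemma explored_start: "explored 0 \<Omega> {} \<H>"
  by (auto simp: explored_def)

lemma exploredD:
  assumes "explored k V A H"
  shows "finite V" "finite A" "finite H" "V \<inter> A = {}" "V \<subseteq> \<Omega>" "H \<subseteq> \<H>" "card A \<le> k"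
    "card (\<Omega> - V) \<le> k"
proof -
  show "card A \<le> k"
    using assms card_mono[of "\<Omega> - V" A] finite_slots unfolding explored_def by (meson finite_Diff le_trans)
qed (use assms finite_slots finite_triples in \<open>auto simp: explored_def intro: finite_subset\<close>)

lemma explored_mono: "explored k V A H \<Longrightarrow> k \<le> k' \<Longrightarrow> explored k' V A H"
  by (auto simp: explored_def)

text \<open>Triples through \<open>x\<close> may be dropped freely, because they now meet the
  occupied set.\<close>

lemma explored_occupy:
  assumes "explored k V A H" "x \<in> V" "{T \<in> H. x \<notin> s T} \<subseteq> H'" "H' \<subseteq> H"
  shows "explored (Suc k) (V - {x}) (insert x A) H'"
proof -
  have "\<Omega> - (V - {x}) = insert x (\<Omega> - V)"
    using assms by (auto simp: explored_def)
  then have "card (\<Omega> - (V - {x})) \<le> Suc k"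
    using assms(1) card_insert_le_m1[of "Suc k" "\<Omega> - V" x] by (simp add: explored_def)
  then show ?thesis
    using assms unfolding explored_def by blast
qed

lemma triple_others:
  assumes "T \<in> \<H>" "x \<in> s T"
  obtains y y' where "s T = {x, y, y'}" "x \<noteq> y" "x \<noteq> y'" "y \<noteq> y'"
proof -
  have "card (s T - {x}) = 2"
    using triple_card[OF assms(1)] assms(2) by simp
  then obtain y y' where "s T - {x} = {y, y'}" "y \<noteq> y'"
    by (auto simp: card_2_iff)
  moreover from this have "s T = {x, y, y'}"
    using assms(2) by blast
  ultimately show ?thesis
    using that by blast
qed

text \<open>By linearity each \<open>y\<close> in \<open>B\<close> shares at most one triple with
  \<open>x\<close>.\<close>

lemma card_triples_meeting:
  assumes "finite B"
  shows "card {T \<in> \<H>. x \<in> s T \<and> (s T - {x}) \<inter> B \<noteq> {}} \<le> card B"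
proof -
  have "card {T \<in> \<H>. x \<in> s T \<and> y \<in> s T \<and> x \<noteq> y} \<le> 1" for y
    using linear finite_triples by (subst One_nat_def, subst card_le_Suc0_iff_eq) auto
  then have "card (\<Union>y\<in>B. {T \<in> \<H>. x \<in> s T \<and> y \<in> s T \<and> x \<noteq> y}) \<le> card B"
    by (intro card_UN_le_one assms)
  also have "(\<Union>y\<in>B. {T \<in> \<H>. x \<in> s T \<and> y \<in> s T \<and> x \<noteq> y}) =
      {T \<in> \<H>. x \<in> s T \<and> (s T - {x}) \<inter> B \<noteq> {}}"
    by auto
  finally show ?thesis .
qed

text \<open>By linearity the two occupied slots of a nearly complete triple determine the triple,
  hence its third slot. There are at most k^2 ordered pairs of occupied slots.\<close>

lemma card_blocked:
  assumes "finite A" "card A \<le> k" "H \<subseteq> \<H>"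
  shows "finite (blocked A H)" "card (blocked A H) \<le> k\<^sup>2"
proof -
  define Y where "Y = (\<lambda>(a, a'). {y. \<exists>T\<in>H. s T = {y, a, a'}})"
  have fin: "finite (Y p)" for p
  proof -
    have "Y p \<subseteq> \<Union> (s ` \<H>)"
      using assms(3) by (auto simp: Y_def)
    moreover have "finite (\<Union> (s ` \<H>))"
      using finite_triples finite_slots triple_subset by (blast intro: finite_subset)
    ultimately show ?thesis
      by (rule finite_subset)
  qed
  have "card (Y p) \<le> 1" for p
  proof (cases p)
    case (Pair a a')
    have "y = y'" if yy: "y \<in> Y p" "y' \<in> Y p" for y y'
    proof -
      obtain T T' where T: "T \<in> \<H>" "s T = {y, a, a'}" "T' \<in> \<H>" "s T' = {y', a, a'}"
        using yy assms(3) by (auto simp: Pair Y_def)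
      have c: "card {y, a, a'} = 3" "card {y', a, a'} = 3"
        using triple_card T by metis+
      then have *: "y \<noteq> a" "y \<noteq> a'" "a \<noteq> a'" "y' \<noteq> a" "y' \<noteq> a'"
        by (auto simp: card_insert_if split: if_splits)
      then have "T = T'"
        using linear[OF T(1,3), of a a'] T by auto
      then show ?thesis
        using T * by auto
    qed
    then show ?thesis
      using fin[of p] by (subst One_nat_def, subst card_le_Suc0_iff_eq) auto
  qed
  then have "card (\<Union>p\<in>A \<times> A. Y p) \<le> card (A \<times> A)"
    by (intro card_UN_le_one) (use assms in auto)
  also have "card (A \<times> A) \<le> k\<^sup>2"
    using assms by (simp add: card_cartesian_product power2_eq_square mult_mono)
  finally have *: "card (\<Union>p\<in>A \<times> A. Y p) \<le> k\<^sup>2" .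
  have sub: "blocked A H \<subseteq> (\<Union>p\<in>A \<times> A. Y p)"
  proof
    fix x assume "x \<in> blocked A H"
    then obtain T where T: "T \<in> H" "x \<in> s T" "s T - {x} \<subseteq> A"
      by (auto simp: blocked_def)
    obtain y y' where y: "s T = {x, y, y'}" "x \<noteq> y" "x \<noteq> y'" "y \<noteq> y'"
      by (rule triple_others[OF subsetD[OF assms(3) T(1)] T(2)])
    have "(y, y') \<in> A \<times> A" "x \<in> Y (y, y')"
      using T(3) y by (auto simp: Y_def intro!: bexI[OF _ T(1)])
    then show "x \<in> (\<Union>p\<in>A \<times> A. Y p)"
      by blast
  qed
  moreover have fin': "finite (\<Union>p\<in>A \<times> A. Y p)"
    using assms fin by auto
  ultimately show "finite (blocked A H)"
    by (rule finite_subset)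
  show "card (blocked A H) \<le> k\<^sup>2"
    using * card_mono[OF fin' sub] by simp
qed

section \<open>One round of improving the occupation bounds\<close>

lemma gas_occupy_le:
  assumes "0 \<le> l" "0 \<le> z" "z \<le> 1" "explored k V A H" "x \<in> V"
  shows "gas l z s (V - {x}) (insert x A) H \<le> gas l z s V A H"
proof -
  have "gas l z s (V - {x}) (insert x A) H \<le> gas l z s (V - {x}) A H"
    by (rule gas_antimono) (use assms exploredD[OF assms(4)] in auto)
  also have "\<dots> \<le> gas l z s V A H"
    using gas_split[of V x l z s A H] gas_nonneg[of l z s "V - {x}" "insert x A" H]
      exploredD[OF assms(4)] assms by simp
  finally show ?thesis .
qed

lemma occ_ge_nonpos:
  assumes "0 \<le> l" "z \<le> 1" "L \<le> 0"
  shows "occ_ge l z k L"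
proof -
  have "L * gas l z s V A H \<le> l * gas l z s (V - {x}) (insert x A) H" for V A H x
    using gas_nonneg[of l z s] assms
    by (meson mult_nonneg_nonneg mult_nonpos_nonneg order_trans)
  then show ?thesis
    by (auto simp: occ_ge_def)
qed

text \<open>The odds of \<open>x\<close> are \<open>l\<close> times one factor per triple through
  \<open>x\<close>. If the other two slots of the triple are undecided and not blocked, applying the
  lower bound to one after the other shows that the factor is at most \<open>1 - z * L^2\<close>;
  the remaining factors are at most 1. All but \<open>k + k^2\<close> of the \<open>d\<close>
  triples are of the first kind.\<close>

lemma occ_le_step:
  assumes l: "0 \<le> l" and z: "0 \<le> z" "z \<le> 1" and L: "0 \<le> L" "L \<le> 1"
    and ge: "occ_ge l z (k + 2) L"
  shows "occ_le l z k (l * (1 - z * L\<^sup>2) ^ (d - (k + k\<^sup>2)))"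
  unfolding occ_le_def
proof (intro allI impI ballI)
  fix V A H x assume st: "explored k V A H" and x: "x \<in> V"
  note stD = exploredD[OF st]
  define Hx where "Hx = {T \<in> H. x \<in> s T}"
  define H0 where "H0 = {T \<in> H. x \<notin> s T}"
  \<comment> \<open>The slots to which the lower bound cannot be applied: the decided ones and the
    blocked ones.\<close>
  define W where "W = (\<Omega> - V) \<union> blocked A H"
  define fresh where "fresh T \<longleftrightarrow> (s T - {x}) \<inter> W = {}" for T
  define q where "q T = (if fresh T then 1 - z * L\<^sup>2 else 1)" for T
  let ?V = "V - {x}" and ?A = "insert x A"
  have H: "H = H0 \<union> Hx"
    by (auto simp: H0_def Hx_def)
  have "z * L\<^sup>2 \<le> 1 * 1\<^sup>2"
    using z L by (intro mult_mono power_mono) auto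
  then have q01: "0 \<le> 1 - z * L\<^sup>2" "1 - z * L\<^sup>2 \<le> 1"
    using z(1) by simp_all
  have xA: "x \<notin> A"
    using stD(4) x by auto
  have "gas l z s ?V ?A (H0 \<union> Hx) \<le> prod q Hx * gas l z s ?V ?A H0"
  proof (rule gas_edges_le)
    fix F' T assume F': "F' \<subseteq> Hx" and T: "T \<in> Hx - F'"
    define H1 where "H1 = H0 \<union> F'"
    have H1: "H0 \<subseteq> H1" "H1 \<subseteq> H" "T \<notin> H1" "T \<in> \<H>" "x \<in> s T" "H1 \<subseteq> \<H>"
      using F' T stD(6) by (auto simp: H1_def H0_def Hx_def)
    have st1: "explored (Suc k) ?V ?A H1"
      by (rule explored_occupy[OF st x]) (use H1 in \<open>auto simp: H0_def\<close>)
    note st1D = exploredD[OF st1]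
    show "gas l z s ?V ?A (insert T (H0 \<union> F')) \<le> q T * gas l z s ?V ?A (H0 \<union> F')"
      unfolding H1_def[symmetric]
    proof (cases "fresh T")
      case False
      have "0 \<le> (if s T \<subseteq> ?V \<union> ?A then l ^ card (s T - ?A) *
          gas l z s (?V - (s T - ?A)) (?A \<union> (s T - ?A)) H1 else 0)"
        using mult_nonneg_nonneg[OF zero_le_power[OF l] gas_nonneg[OF l z(2)]] by (simp only: split: if_split) blast
      then show "gas l z s ?V ?A (insert T H1) \<le> q T * gas l z s ?V ?A H1"
        using False st1D H1 z by (subst gas_insert_edge) (auto simp: q_def)
    next
      case True
      obtain y y' where y: "s T = {x, y, y'}" "x \<noteq> y" "x \<noteq> y'" "y \<noteq> y'"
        using triple_others[of T x] H1 by blast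
      have yV: "y \<in> ?V" "y' \<in> ?V - {y}"
        using True y triple_subset[OF H1(4)] by (auto simp: fresh_def W_def)
      have ynA: "y \<notin> A" "y' \<notin> A"
        using yV stD by auto
      \<comment> \<open>\<open>T\<close> contains \<open>x\<close>, \<open>y\<close> and
        \<open>y'\<close> and is itself absent from \<open>H1\<close>, so by linearity no triple of
        \<open>H1\<close> contains two of them. Hence occupying \<open>x\<close>, and then
        \<open>y\<close>, creates no new obstruction at \<open>y\<close> or \<open>y'\<close>, which
        stay unblocked.\<close>
      have other: "x \<notin> s T'" "\<not> (y \<in> s T' \<and> y' \<in> s T')"
        if "T' \<in> H1" "y \<in> s T' \<or> y' \<in> s T'" for T'
      proof -
        have "T' \<noteq> T" "T' \<in> \<H>"
          using that H1 by auto
        then show "x \<notin> s T'" "\<not> (y \<in> s T' \<and> y' \<in> s T')"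
          using linear[OF \<open>T' \<in> \<H>\<close> H1(4)] y that by blast+
      qed
      have nb: "y \<notin> blocked A H" "y' \<notin> blocked A H"
        using True y by (auto simp: fresh_def W_def)
      have y1: "y \<notin> blocked ?A H1"
        using other nb H1(2) unfolding blocked_def by blast
      have y2: "y' \<notin> blocked (insert y ?A) H1"
        using other nb H1(2) unfolding blocked_def by blast
      have st2: "explored (k + 2) (?V - {y}) (insert y ?A) H1"
        using explored_occupy[OF st1 yV(1), of H1] by simp
      have "L\<^sup>2 * gas l z s ?V ?A H1 = L * (L * gas l z s ?V ?A H1)"
        by (simp add: power2_eq_square)
      also have "\<dots> \<le> L * (l * gas l z s (?V - {y}) (insert y ?A) H1)"
        using ge explored_mono[OF st1, of "k + 2"] yV y1 L unfolding occ_ge_def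
        by (intro mult_left_mono) auto
      also have "\<dots> = l * (L * gas l z s (?V - {y}) (insert y ?A) H1)"
        by simp
      also have "\<dots> \<le> l * (l * gas l z s (?V - {y} - {y'}) (insert y' (insert y ?A)) H1)"
        using ge st2 yV y2 l unfolding occ_ge_def by (intro mult_left_mono) auto
      finally have *: "L\<^sup>2 * gas l z s ?V ?A H1 \<le>
          l\<^sup>2 * gas l z s (?V - {y} - {y'}) (insert y' (insert y ?A)) H1"
        by (simp add: power2_eq_square mult.assoc)
      have sT: "s T - ?A = {y, y'}" "s T \<subseteq> ?V \<union> ?A" "card {y, y'} = 2"
        using y ynA yV by auto
      have sets: "?V - {y, y'} = ?V - {y} - {y'}" "?A \<union> {y, y'} = insert y' (insert y ?A)"
        by auto
      have "gas l z s ?V ?A (insert T H1) = gas l z s ?V ?A H1 -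
          z * (l\<^sup>2 * gas l z s (?V - {y} - {y'}) (insert y' (insert y ?A)) H1)"
        using st1D H1 by (subst gas_insert_edge) (auto simp only: sT sets if_True)
      also have "\<dots> \<le> gas l z s ?V ?A H1 - z * (L\<^sup>2 * gas l z s ?V ?A H1)"
        using * z by (intro diff_left_mono mult_left_mono) auto
      finally show "gas l z s ?V ?A (insert T H1) \<le> q T * gas l z s ?V ?A H1"
        using True by (simp add: q_def algebra_simps)
    qed
  qed (use stD q01 in \<open>auto simp: Hx_def q_def\<close>)
  also have "gas l z s ?V ?A H0 = gas l z s ?V A H"
    unfolding H0_def by (rule gas_occupy_isolated) (use xA in auto)
  finally have main: "gas l z s ?V ?A H \<le> prod q Hx * gas l z s ?V A H"
    using H by simp
  have "prod q Hx = (1 - z * L\<^sup>2) ^ card {T \<in> Hx. fresh T}"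
    using stD by (simp add: q_def Hx_def prod.If_cases Int_def)
  also have "\<dots> \<le> (1 - z * L\<^sup>2) ^ (d - (k + k\<^sup>2))"
  proof (intro power_decreasing q01)
    have fb: "finite (blocked A H)" and cb: "card (blocked A H) \<le> k\<^sup>2"
      using card_blocked[of A k H] stD by auto
    have "card W \<le> card (\<Omega> - V) + card (blocked A H)"
      unfolding W_def by (rule card_Un_le)
    then have cW: "card W \<le> k + k\<^sup>2"
      using cb stD by simp
    have "finite W"
      using fb finite_slots by (auto simp: W_def)
    \<comment> \<open>Triples that are missing from \<open>H\<close> meet \<open>A\<close>, so they
      are covered by the second set; this is why all \<open>d\<close> triples through
      \<open>x\<close> can be counted.\<close>
    have "{T \<in> \<H>. x \<in> s T} \<subseteq> {T \<in> Hx. fresh T} \<union> {T \<in> \<H>. x \<in> s T \<and> (s T - {x}) \<inter> W \<noteq> {}}"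
    proof
      fix T assume T: "T \<in> {T \<in> \<H>. x \<in> s T}"
      show "T \<in> {T \<in> Hx. fresh T} \<union> {T \<in> \<H>. x \<in> s T \<and> (s T - {x}) \<inter> W \<noteq> {}}"
      proof (cases "fresh T")
        case True
        then have "s T \<inter> A = {}"
          using st xA by (auto simp: fresh_def W_def explored_def)
        then have "T \<in> H"
          using st T by (auto simp: explored_def)
        then show ?thesis
          using True T by (auto simp: Hx_def)
      qed (use T in \<open>auto simp: fresh_def\<close>)
    qed
    then have "card {T \<in> \<H>. x \<in> s T} \<le>
        card ({T \<in> Hx. fresh T} \<union> {T \<in> \<H>. x \<in> s T \<and> (s T - {x}) \<inter> W \<noteq> {}})"
      using stD finite_triples by (intro card_mono) (auto simp: Hx_def)
    also have "\<dots> \<le> card {T \<in> Hx. fresh T} + card {T \<in> \<H>. x \<in> s T \<and> (s T - {x}) \<inter> W \<noteq> {}}"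
      by (rule card_Un_le)
    also have "\<dots> \<le> card {T \<in> Hx. fresh T} + (k + k\<^sup>2)"
      using card_triples_meeting[OF \<open>finite W\<close>, of x] cW by simp
    finally show "d - (k + k\<^sup>2) \<le> card {T \<in> Hx. fresh T}"
      using regular[of x] x stD by auto
  qed
  finally have "prod q Hx * gas l z s ?V A H \<le> (1 - z * L\<^sup>2) ^ (d - (k + k\<^sup>2)) * gas l z s V A H"
  proof (rule mult_mono)
    show "gas l z s ?V A H \<le> gas l z s V A H"
      using gas_split[of V x l z s A H] gas_nonneg[of l z s ?V ?A H] stD x l z by simp
  qed (use q01 gas_nonneg l z in auto)
  then show "l * gas l z s ?V ?A H \<le> l * (1 - z * L\<^sup>2) ^ (d - (k + k\<^sup>2)) * gas l z s V A H"
    using main l by (simp add: mult.assoc mult_left_mono)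
qed

text \<open>At most \<open>k\<close> triples through \<open>x\<close> meet the occupied set. Since
  \<open>x\<close> is not blocked, such a triple still has a slot that is not occupied, and the
  trivial bound \<open>l\<close> on its occupation probability gives the factor
  \<open>1 - z * l\<close>. Every other triple has a factor of at least
  \<open>1 - z * U^2\<close>.\<close>

lemma occ_ge_step:
  assumes l: "0 \<le> l" "l \<le> 1" and z: "0 \<le> z" "z \<le> 1" and U: "0 \<le> U" "U \<le> 1"
    and le: "occ_le l z (k + 2) U"
  shows "occ_ge l z k (l * ((1 - z * U\<^sup>2) ^ d * (1 - z * l) ^ k) / (1 + l))"
  unfolding occ_ge_def
proof (intro allI impI ballI)
  fix V A H x assume st: "explored k V A H" and x': "x \<in> V - blocked A H"
  note stD = exploredD[OF st]
  define Hx where "Hx = {T \<in> H. x \<in> s T}"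
  define H0 where "H0 = {T \<in> H. x \<notin> s T}"
  define far where "far T \<longleftrightarrow> (s T - {x}) \<inter> A = {}" for T
  define q where "q T = (if far T then 1 - z * U\<^sup>2 else 1 - z * l)" for T
  define Q where "Q = (1 - z * U\<^sup>2) ^ d * (1 - z * l) ^ k"
  let ?V = "V - {x}" and ?A = "insert x A"
  have x: "x \<in> V"
    using x' by simp
  have H: "H = H0 \<union> Hx"
    by (auto simp: H0_def Hx_def)
  have "z * U\<^sup>2 \<le> 1 * 1\<^sup>2" "z * l \<le> 1 * 1"
    using z U l by (intro mult_mono power_mono; simp)+
  then have q01: "0 \<le> 1 - z * U\<^sup>2" "1 - z * U\<^sup>2 \<le> 1" "0 \<le> 1 - z * l" "1 - z * l \<le> 1"
    using z(1) l(1) by simp_all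
  have xA: "x \<notin> A"
    using stD(4) x by auto
  have Q: "Q \<le> prod q Hx"
  proof -
    have "prod q Hx = (1 - z * U\<^sup>2) ^ card {T \<in> Hx. far T} * (1 - z * l) ^ card {T \<in> Hx. \<not> far T}"
      using stD by (simp add: q_def Hx_def prod.If_cases Int_def)
    moreover have "card {T \<in> Hx. far T} \<le> d"
      using regular[of x] x stD finite_triples card_mono[of "{T \<in> \<H>. x \<in> s T}" "{T \<in> Hx. far T}"]
      by (auto simp: Hx_def)
    moreover have "card {T \<in> Hx. \<not> far T} \<le> k"
    proof -
      have "card {T \<in> Hx. \<not> far T} \<le> card {T \<in> \<H>. x \<in> s T \<and> (s T - {x}) \<inter> A \<noteq> {}}"
        using stD finite_triples by (intro card_mono) (auto simp: Hx_def far_def)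
      also have "\<dots> \<le> card A"
        by (rule card_triples_meeting) (use stD in auto)
      finally show ?thesis
        using stD by simp
    qed
    ultimately show ?thesis
      unfolding Q_def using q01 by (auto intro!: mult_mono power_decreasing)
  qed
  have "prod q Hx * gas l z s ?V ?A H0 \<le> gas l z s ?V ?A (H0 \<union> Hx)"
  proof (rule gas_edges_ge)
    fix F' T assume F': "F' \<subseteq> Hx" and T: "T \<in> Hx - F'"
    define H1 where "H1 = H0 \<union> F'"
    have H1: "H0 \<subseteq> H1" "H1 \<subseteq> H" "T \<notin> H1" "T \<in> \<H>" "x \<in> s T" "H1 \<subseteq> \<H>" "T \<in> H"
      using F' T stD(6) by (auto simp: H1_def H0_def Hx_def)
    have st1: "explored (Suc k) ?V ?A H1"
      by (rule explored_occupy[OF st x]) (use H1 in \<open>auto simp: H0_def\<close>)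
    note st1D = exploredD[OF st1]
    have nn: "0 \<le> gas l z s ?V ?A H1"
      using gas_nonneg l z by blast
    obtain y y' where y: "s T = {x, y, y'}" "x \<noteq> y" "x \<noteq> y'" "y \<noteq> y'"
      using triple_others[of T x] H1 by blast
    have ins: "gas l z s ?V ?A (insert T H1) = gas l z s ?V ?A H1 -
      z * (if s T \<subseteq> ?V \<union> ?A then l ^ card (s T - ?A) *
          gas l z s (?V - (s T - ?A)) (?A \<union> (s T - ?A)) H1 else 0)"
      by (rule gas_insert_edge) (use st1D H1 in auto)
    consider "\<not> s T \<subseteq> ?V \<union> ?A" | "s T \<subseteq> ?V \<union> ?A" "far T" | "s T \<subseteq> ?V \<union> ?A" "\<not> far T"
      by blast
    then show "q T * gas l z s ?V ?A (H0 \<union> F') \<le> gas l z s ?V ?A (insert T (H0 \<union> F'))"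
      unfolding H1_def[symmetric]
    proof cases
      \<comment> \<open>A slot of \<open>T\<close> is decided and vacant, so inserting
        \<open>T\<close> changes nothing.\<close>
      case 1
      have "q T \<le> 1"
        using q01 by (simp add: q_def)
      then show "q T * gas l z s ?V ?A H1 \<le> gas l z s ?V ?A (insert T H1)"
        using ins 1 mult_right_mono[OF _ nn, of "q T" 1] by simp
    next
      case 2
      have ynA: "y \<notin> A" "y' \<notin> A"
        using 2 y by (auto simp: far_def)
      then have yV: "y \<in> ?V" "y' \<in> ?V - {y}"
        using 2 y by auto
      have st2: "explored (k + 2) (?V - {y}) (insert y ?A) H1"
        using explored_occupy[OF st1 yV(1), of H1] by simp
      have "l * (l * gas l z s (?V - {y} - {y'}) (insert y' (insert y ?A)) H1) \<le>
          l * (U * gas l z s (?V - {y}) (insert y ?A) H1)"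
        using le st2 yV l unfolding occ_le_def by (intro mult_left_mono) auto
      also have "\<dots> = U * (l * gas l z s (?V - {y}) (insert y ?A) H1)"
        by simp
      also have "\<dots> \<le> U * (U * gas l z s ?V ?A H1)"
        using le explored_mono[OF st1, of "k + 2"] yV U unfolding occ_le_def
        by (intro mult_left_mono) auto
      finally have *: "l\<^sup>2 * gas l z s (?V - {y} - {y'}) (insert y' (insert y ?A)) H1 \<le>
          U\<^sup>2 * gas l z s ?V ?A H1"
        by (simp add: power2_eq_square mult.assoc)
      have sT: "s T - ?A = {y, y'}" "card {y, y'} = 2"
        using y ynA yV by auto
      have sets: "?V - {y, y'} = ?V - {y} - {y'}" "?A \<union> {y, y'} = insert y' (insert y ?A)"
        by auto
      have "q T * gas l z s ?V ?A H1 = gas l z s ?V ?A H1 - z * (U\<^sup>2 * gas l z s ?V ?A H1)"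
        using 2 by (simp add: q_def algebra_simps)
      also have "\<dots> \<le> gas l z s ?V ?A H1 -
          z * (l\<^sup>2 * gas l z s (?V - {y} - {y'}) (insert y' (insert y ?A)) H1)"
        using * z by (intro diff_left_mono mult_left_mono) auto
      also have "\<dots> = gas l z s ?V ?A (insert T H1)"
        unfolding ins using 2 by (simp only: sT sets if_True)
      finally show "q T * gas l z s ?V ?A H1 \<le> gas l z s ?V ?A (insert T H1)" .
    next
      case 3
      have "\<not> {y, y'} \<subseteq> A"
        using x' H1 y by (auto simp: blocked_def)
      then obtain w where w: "s T - ?A = {w}" "w \<in> ?V"
        using 3 y stD by (auto simp: far_def)
      have "q T * gas l z s ?V ?A H1 = gas l z s ?V ?A H1 - z * (l * gas l z s ?V ?A H1)"
        using 3 by (simp add: q_def algebra_simps)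
      also have "\<dots> \<le> gas l z s ?V ?A H1 - z * (l * gas l z s (?V - {w}) (insert w ?A) H1)"
        using z l st1 w gas_occupy_le by (intro diff_left_mono mult_left_mono) auto
      also have "\<dots> = gas l z s ?V ?A (insert T H1)"
        unfolding ins using 3 by (simp add: w)
      finally show "q T * gas l z s ?V ?A H1 \<le> gas l z s ?V ?A (insert T H1)" .
    qed
  qed (use stD q01 in \<open>auto simp: Hx_def q_def\<close>)
  also have "gas l z s ?V ?A H0 = gas l z s ?V A H"
    unfolding H0_def by (rule gas_occupy_isolated) (use xA in auto)
  finally have main: "prod q Hx * gas l z s ?V A H \<le> gas l z s ?V ?A H"
    using H by simp
  have nn: "0 \<le> gas l z s ?V A H" "0 \<le> Q"
    using gas_nonneg l z q01 by (auto simp: Q_def)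
  \<comment> \<open>From odds to probability: the total is at most \<open>1 + l\<close> times the
    gas with \<open>x\<close> vacant.\<close>
  have "Q * gas l z s V A H = Q * gas l z s ?V A H + Q * (l * gas l z s ?V ?A H)"
    using gas_split[of V x l z s A H] stD x by (simp add: algebra_simps)
  also have "\<dots> \<le> Q * gas l z s ?V A H + Q * (l * gas l z s ?V A H)"
    using gas_antimono[of l z A ?A H s ?V] l z stD nn
    by (intro add_left_mono mult_left_mono) auto
  also have "\<dots> = (1 + l) * (Q * gas l z s ?V A H)"
    by (simp add: algebra_simps)
  also have "\<dots> \<le> (1 + l) * gas l z s ?V ?A H"
    using main mult_right_mono[OF Q nn(1)] l by (intro mult_left_mono) auto
  finally have "l * (Q * gas l z s V A H) \<le> l * ((1 + l) * gas l z s ?V ?A H)"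
    using l by (intro mult_left_mono)
  then show "l * ((1 - z * U\<^sup>2) ^ d * (1 - z * l) ^ k) / (1 + l) * gas l z s V A H
      \<le> l * gas l z s ?V ?A H"
    using l by (simp add: Q_def field_simps)
qed

end

section \<open>Slot marginals\<close>

definition triples :: "nat \<Rightarrow> nat set set" where
  "triples n = {t. t \<subseteq> {..<n} \<and> card t = 3}"

definition sides :: "nat set \<Rightarrow> nat set set" where
  "sides t = {e. e \<subseteq> t \<and> card e = 2}"

lemma finite_edge_slots [simp]: "finite (edge_slots n)"
  by (rule finite_subset[of _ "Pow {..<n}"]) (auto simp: edge_slots_def)

lemma finite_triples_nat [simp]: "finite (triples n)"
  by (rule finite_subset[of _ "Pow {..<n}"]) (auto simp: triples_def)

lemma card_triples_containing:
  assumes "x \<in> edge_slots n"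
  shows "card {t \<in> triples n. x \<in> sides t} = n - 2"
proof -
  have x: "x \<subseteq> {..<n}" "card x = 2" "finite x"
    using assms by (auto simp: edge_slots_def intro: finite_subset)
  have "bij_betw (\<lambda>w. insert w x) ({..<n} - x) {t \<in> triples n. x \<in> sides t}"
    unfolding bij_betw_def
  proof (intro conjI set_eqI iffI)
    show "inj_on (\<lambda>w. insert w x) ({..<n} - x)"
      by (rule inj_onI) auto
  next
    fix t assume "t \<in> (\<lambda>w. insert w x) ` ({..<n} - x)"
    then show "t \<in> {t \<in> triples n. x \<in> sides t}"
      using x by (auto simp: triples_def sides_def)
  next
    fix t assume t: "t \<in> {t \<in> triples n. x \<in> sides t}"
    then have "card (t - x) = 1"
      using x by (subst card_Diff_subset) (auto simp: triples_def sides_def)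
    then obtain w where "t - x = {w}"
      by (auto simp: card_1_singleton_iff)
    then have "t = insert w x" "w \<in> {..<n} - x"
      using t by (auto simp: triples_def sides_def)
    then show "t \<in> (\<lambda>w. insert w x) ` ({..<n} - x)"
      by blast
  qed
  then have "card {t \<in> triples n. x \<in> sides t} = card ({..<n} - x)"
    by (simp add: bij_betw_same_card)
  then show ?thesis
    using x by (simp add: card_Diff_subset)
qed

lemma card_sides: "card t = 3 \<Longrightarrow> card (sides t) = 3"
  using n_subsets[of t 2] by (simp add: sides_def card_ge_0_finite choose_two)

interpretation tri: linear_triple_system "edge_slots n" "triples n" sides "n - 2" for n
proof
  fix T assume "T \<in> triples n"
  then show "sides T \<subseteq> edge_slots n" "card (sides T) = 3"
    by (auto simp: sides_def triples_def edge_slots_def card_sides[unfolded sides_def])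
next
  fix T T' x y
  assume T: "T \<in> triples n" "T' \<in> triples n" "x \<in> sides T" "x \<in> sides T'"
    "y \<in> sides T" "y \<in> sides T'" "x \<noteq> y"
  \<comment> \<open>Two distinct edges of a triangle span all of it, so they lie in no other
    triangle.\<close>
  have "t = x \<union> y" if "t \<in> triples n" "x \<in> sides t" "y \<in> sides t" for t
  proof -
    have fin: "finite t" and t: "card t = 3" "x \<union> y \<subseteq> t" "card x = 2" "card y = 2"
      using that by (auto simp: triples_def sides_def intro: finite_subset)
    have "\<not> y \<subseteq> x"
      using T(7) t fin card_subset_eq[of x y] by (auto intro: finite_subset)
    then have "card x < card (x \<union> y)"
      using t fin by (intro psubset_card_mono) (auto intro: finite_subset)
    then show ?thesis
      using t fin card_seteq[of t "x \<union> y"] by auto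
  qed
  then show "T = T'"
    using T by metis
qed (auto simp: card_triples_containing)

section \<open>Asymptotic slot densities for the triangle system\<close>

abbreviation graph_gas :: "nat \<Rightarrow> real \<Rightarrow> real \<Rightarrow> real" where
  "graph_gas n l z \<equiv> gas l z sides (edge_slots n) {} (triples n)"

text \<open>Says that the limsup of \<open>sqrt n\<close> times the largest occupation probability
  is at most \<open>U\<close>; the slack \<open>U' > U\<close> encodes the limsup. As
  \<open>k\<close> is fixed before \<open>n\<close>, the convergence may depend on
  \<open>k\<close>.\<close>

definition occ_above :: "real \<Rightarrow> real \<Rightarrow> real \<Rightarrow> bool" where
  "occ_above c z U \<longleftrightarrow> (\<forall>k. \<forall>U'>U. \<forall>\<^sub>F n in sequentially.
     tri.occ_le n (c / sqrt (real n)) z k (U' / sqrt (real n)))"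

definition occ_below :: "real \<Rightarrow> real \<Rightarrow> real \<Rightarrow> bool" where
  "occ_below c z L \<longleftrightarrow> (\<forall>k. \<forall>L'<L. \<forall>\<^sub>F n in sequentially.
     tri.occ_ge n (c / sqrt (real n)) z k (L' / sqrt (real n)))"

lemma occ_le_mono:
  assumes "tri.occ_le n l z k U" "U \<le> U'" "0 \<le> l" "z \<le> 1"
  shows "tri.occ_le n l z k U'"
  using assms gas_nonneg[OF assms(3,4)] unfolding tri.occ_le_def
  by (meson mult_right_mono order_trans)

lemma occ_ge_antimono:
  assumes "tri.occ_ge n l z k L" "L' \<le> L" "0 \<le> l" "z \<le> 1"
  shows "tri.occ_ge n l z k L'"
  using assms gas_nonneg[OF assms(3,4)] unfolding tri.occ_ge_def
  by (meson mult_right_mono order_trans)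

text \<open>The offset \<open>j\<close> absorbs the difference between \<open>n\<close> and the
  degree \<open>n - 2\<close> as well as the boundedly many triples that are given up in each
  round.\<close>

lemma tendsto_one_minus_power:
  fixes a :: real
  shows "(\<lambda>n. (1 - a / real n) ^ (n - j)) \<longlonglongrightarrow> exp (- a)"
proof -
  have *: "(\<lambda>n. (1 + (- a) / real n)) \<longlonglongrightarrow> 1 + 0"
    by (intro tendsto_add tendsto_const lim_const_over_n)
  then have "(\<lambda>n. (1 + (- a) / real n) ^ n / (1 + (- a) / real n) ^ j) \<longlonglongrightarrow> exp (- a) / (1 + 0) ^ j"
    by (intro tendsto_divide tendsto_power tendsto_exp_limit_sequentially) auto
  moreover have "\<forall>\<^sub>F n in sequentially.
      (1 + (- a) / real n) ^ n / (1 + (- a) / real n) ^ j = (1 - a / real n) ^ (n - j)"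
    using order_tendstoD(1)[OF *, of 0, simplified] eventually_ge_at_top[of j]
  proof eventually_elim
    case (elim n)
    then have "1 - a / real n \<noteq> 0"
      by linarith
    from power_diff[OF this elim(2)] show ?case
      by simp
  qed
  ultimately show ?thesis
    by (simp cong: filterlim_cong)
qed

lemma tendsto_over_sqrt: "(\<lambda>n. a / sqrt (real n)) \<longlonglongrightarrow> 0"
  by (intro tendsto_divide_0[OF tendsto_const] filterlim_at_top_imp_at_infinity
      filterlim_compose[OF sqrt_at_top filterlim_real_sequentially])

lemma occ_above_from_below:
  assumes c: "0 \<le> c" and z: "0 \<le> z" "z \<le> 1" and L: "0 \<le> L" and below: "occ_below c z L"
  shows "occ_above c z (c * exp (- z * L\<^sup>2))"
  unfolding occ_above_def
proof (intro allI impI)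
  fix k U' assume U': "c * exp (- z * L\<^sup>2) < U'"
  \<comment> \<open>\<open>occ_below\<close> supplies only bounds strictly below \<open>L\<close>,
    while \<open>occ_le_step\<close> wants a nonnegative one. For \<open>L = 0\<close> the trivial
    bound 0 is used; otherwise some \<open>L'\<close> slightly below \<open>L\<close> is still good
    enough by continuity.\<close>
  have "\<exists>L'\<ge>0. c * exp (- z * L'\<^sup>2) < U' \<and> (\<forall>\<^sub>F n in sequentially.
     tri.occ_ge n (c / sqrt (real n)) z (k + 2) (L' / sqrt (real n)))"
  proof (cases "L = 0")
    case True
    then show ?thesis
      using U' c z by (intro exI[of _ 0]) (auto intro!: tri.occ_ge_nonpos always_eventually)
  next
    case False
    have "((\<lambda>x. c * exp (- z * x\<^sup>2)) \<longlongrightarrow> c * exp (- z * L\<^sup>2)) (at_left L)"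
      by (intro tendsto_intros)
    then have "\<forall>\<^sub>F x in at_left L. c * exp (- z * x\<^sup>2) < U'"
      using U' by (rule order_tendstoD)
    moreover have "\<forall>\<^sub>F x in at_left L. x \<in> {0<..<L}"
      using False L by (intro eventually_at_left_real) auto
    ultimately have "\<forall>\<^sub>F x in at_left L. 0 \<le> x \<and> c * exp (- z * x\<^sup>2) < U' \<and> x < L"
      by eventually_elim auto
    then obtain x where "0 \<le> x" "c * exp (- z * x\<^sup>2) < U'" "x < L"
      using eventually_happens'[OF trivial_limit_at_left_real] by blast
    then show ?thesis
      using below by (auto simp: occ_below_def)
  qed
  then obtain L' where L': "0 \<le> L'" "c * exp (- z * L'\<^sup>2) < U'" and
    ev: "\<forall>\<^sub>F n in sequentially. tri.occ_ge n (c / sqrt (real n)) z (k + 2) (L' / sqrt (real n))"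
    by blast
  have "(\<lambda>n. c * (1 - z * L'\<^sup>2 / real n) ^ (n - (2 + (k + k\<^sup>2)))) \<longlonglongrightarrow> c * exp (- (z * L'\<^sup>2))"
    by (intro tendsto_mult tendsto_const tendsto_one_minus_power)
  then have "\<forall>\<^sub>F n in sequentially. c * (1 - z * L'\<^sup>2 / real n) ^ (n - (2 + (k + k\<^sup>2))) < U'"
    using L' by (intro order_tendstoD(2)) auto
  moreover have "\<forall>\<^sub>F n in sequentially. L' / sqrt (real n) < 1"
    by (rule order_tendstoD(2)[OF tendsto_over_sqrt]) auto
  ultimately show "\<forall>\<^sub>F n in sequentially. tri.occ_le n (c / sqrt (real n)) z k (U' / sqrt (real n))"
    using ev eventually_gt_at_top[of 0]
  proof eventually_elim
    case (elim n)
    have "tri.occ_le n (c / sqrt (real n)) z k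
       (c / sqrt (real n) * (1 - z * (L' / sqrt (real n))\<^sup>2) ^ (n - 2 - (k + k\<^sup>2)))"
      by (rule tri.occ_le_step) (use elim c z L' in auto)
    moreover have "c / sqrt (real n) * (1 - z * (L' / sqrt (real n))\<^sup>2) ^ (n - 2 - (k + k\<^sup>2)) =
        (c * (1 - z * L'\<^sup>2 / real n) ^ (n - (2 + (k + k\<^sup>2)))) / sqrt (real n)"
      by (simp add: power_divide diff_diff_left)
    moreover have "\<dots> \<le> U' / sqrt (real n)"
      using elim by (intro divide_right_mono) auto
    ultimately show ?case
      using occ_le_mono c z by auto
  qed
qed

lemma occ_below_from_above:
  assumes c: "0 \<le> c" and z: "0 \<le> z" "z \<le> 1" and U: "0 \<le> U" and above: "occ_above c z U"
  shows "occ_below c z (c * exp (- z * U\<^sup>2))"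
  unfolding occ_below_def
proof (intro allI impI)
  fix k L' assume L': "L' < c * exp (- z * U\<^sup>2)"
  have "((\<lambda>x. c * exp (- z * x\<^sup>2)) \<longlongrightarrow> c * exp (- z * U\<^sup>2)) (at_right U)"
    by (intro tendsto_intros)
  then have "\<forall>\<^sub>F x in at_right U. L' < c * exp (- z * x\<^sup>2)"
    using L' by (rule order_tendstoD)
  moreover have "\<forall>\<^sub>F x in at_right U. x > U"
    by (rule eventually_at_right_less)
  ultimately have "\<forall>\<^sub>F x in at_right U. L' < c * exp (- z * x\<^sup>2) \<and> U < x"
    by eventually_elim auto
  then obtain U' where U': "L' < c * exp (- z * U'\<^sup>2)" "U < U'"
    using eventually_happens'[OF trivial_limit_at_right_real] by blast
  then have ev: "\<forall>\<^sub>F n in sequentially. tri.occ_le n (c / sqrt (real n)) z (k + 2) (U' / sqrt (real n))"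
    using above by (auto simp: occ_above_def)
  \<comment> \<open>The crude factors for the \<open>k\<close> triples near occupied slots and the
    passage from odds to probabilities all tend to 1, as \<open>c / sqrt n\<close> tends to 0 while
    \<open>k\<close> is fixed.\<close>
  have "(\<lambda>n. c * ((1 - z * U'\<^sup>2 / real n) ^ (n - 2) * (1 - z * (c / sqrt (real n))) ^ k) /
      (1 + c / sqrt (real n))) \<longlonglongrightarrow> c * (exp (- (z * U'\<^sup>2)) * (1 - z * 0) ^ k) / (1 + 0)"
    by (intro tendsto_intros tendsto_one_minus_power tendsto_over_sqrt) auto
  then have "\<forall>\<^sub>F n in sequentially. L' < c * ((1 - z * U'\<^sup>2 / real n) ^ (n - 2) *
      (1 - z * (c / sqrt (real n))) ^ k) / (1 + c / sqrt (real n))"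
    using U' by (intro order_tendstoD(1)) auto
  moreover have "\<forall>\<^sub>F n in sequentially. U' / sqrt (real n) < 1"
    by (rule order_tendstoD(2)[OF tendsto_over_sqrt]) auto
  moreover have "\<forall>\<^sub>F n in sequentially. c / sqrt (real n) < 1"
    by (rule order_tendstoD(2)[OF tendsto_over_sqrt]) auto
  ultimately show "\<forall>\<^sub>F n in sequentially. tri.occ_ge n (c / sqrt (real n)) z k (L' / sqrt (real n))"
    using ev eventually_gt_at_top[of 0]
  proof eventually_elim
    case (elim n)
    let ?l = "c / sqrt (real n)"
    have "tri.occ_ge n ?l z k (?l * ((1 - z * (U' / sqrt (real n))\<^sup>2) ^ (n - 2) *
        (1 - z * ?l) ^ k) / (1 + ?l))"
      by (rule tri.occ_ge_step) (use elim c z U U' in auto)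
    moreover have "?l * ((1 - z * (U' / sqrt (real n))\<^sup>2) ^ (n - 2) * (1 - z * ?l) ^ k) / (1 + ?l) =
        (c * ((1 - z * U'\<^sup>2 / real n) ^ (n - 2) * (1 - z * ?l) ^ k) / (1 + ?l)) / sqrt (real n)"
      by (simp add: power_divide)
    moreover have "L' / sqrt (real n) \<le> \<dots>"
      using elim by (intro divide_right_mono) auto
    ultimately show ?case
      using occ_ge_antimono c z by auto
  qed
qed

text \<open>The slope at the fixed point \<open>b\<close> is \<open>- 2 z b^2\<close>, so the
  hypothesis on \<open>b\<close> is local stability there. Globally, with \<open>y = 2 z b^2\<close>
  and \<open>t = 2 z x^2\<close>, the squared slope equals \<open>y exp(y) t exp(-t)\<close>. Since
  \<open>t exp(-t)\<close> never exceeds \<open>exp(-1)\<close> and \<open>y < 1\<close>, this is at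
  most \<open>y\<close>.\<close>

lemma gaussian_map_contraction:
  fixes b z :: real
  defines "f \<equiv> \<lambda>x. b * exp (z * b\<^sup>2) * exp (- z * x\<^sup>2)"
  assumes z: "0 \<le> z" and b: "0 \<le> b" "2 * z * b\<^sup>2 < 1"
  shows "\<bar>f x - f y\<bar> \<le> sqrt (2 * z * b\<^sup>2) * \<bar>x - y\<bar>"
proof -
  let ?f' = "\<lambda>x. b * exp (z * b\<^sup>2) * (exp (- z * x\<^sup>2) * (- z * (2 * x)))"
  have "norm (f x - f y) \<le> sqrt (2 * z * b\<^sup>2) * norm (x - y)"
  proof (rule field_differentiable_bound[of UNIV])
    fix x :: real
    show "(f has_field_derivative ?f' x) (at x within UNIV)"
      unfolding f_def by (auto intro!: derivative_eq_intros)
    define t where "t = 2 * z * x\<^sup>2"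
    define y where "y = 2 * z * b\<^sup>2"
    have y: "0 \<le> y" "y < 1"
      using z b by (auto simp: y_def)
    have "t \<le> exp (t - 1)"
      using exp_ge_add_one_self[of "t - 1"] by simp
    then have "t * exp (- t) \<le> exp (t - 1) * exp (- t)"
      by (rule mult_right_mono) simp
    then have "t * exp (- t) \<le> exp (- 1)"
      by (simp flip: exp_add)
    then have "y * exp y * (t * exp (- t)) \<le> y * exp y * exp (- 1)"
      using y by (intro mult_left_mono) auto
    also have "\<dots> = y * exp (y - 1)"
      by (simp add: exp_diff exp_minus divide_inverse)
    also have "\<dots> \<le> y * 1"
      using y by (intro mult_left_mono) auto
    finally have le: "y * exp y * (t * exp (- t)) \<le> y"
      by simp
    have ey: "exp y = exp (z * b\<^sup>2) * exp (z * b\<^sup>2)"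
      by (simp add: y_def flip: exp_add)
    have et: "exp (- t) = exp (- z * x\<^sup>2) * exp (- z * x\<^sup>2)"
      by (simp add: t_def flip: exp_add)
    have "(?f' x)\<^sup>2 = y * exp y * (t * exp (- t))"
      unfolding ey et by (simp add: y_def t_def power2_eq_square)
    then have "\<bar>?f' x\<bar> \<le> sqrt y"
      using le by (metis real_sqrt_abs real_sqrt_le_mono)
    then have "\<bar>?f' x\<bar> \<le> sqrt (2 * z * b\<^sup>2)"
      by (simp only: y_def)
    then show "norm (?f' x) \<le> sqrt (2 * z * b\<^sup>2)"
      by (simp only: real_norm_def)
  qed auto
  then show ?thesis
    by simp
qed

text \<open>Starting from the trivial lower bound 0, each application of the decreasing map
  \<open>f\<close> exchanges the two kinds of bounds: even iterates bound from below, odd ones from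
  above.\<close>

lemma occ_iterates:
  fixes b z :: real
  defines "c \<equiv> b * exp (z * b\<^sup>2)"
  defines "f \<equiv> \<lambda>x. c * exp (- z * x\<^sup>2)"
  assumes z: "0 \<le> z" "z \<le> 1" and b: "0 \<le> b"
  shows "occ_below c z ((f ^^ (2 * j)) 0) \<and> occ_above c z ((f ^^ (2 * j + 1)) 0)"
proof -
  have c: "0 \<le> c"
    using b by (simp add: c_def)
  have nn: "0 \<le> (f ^^ i) 0" for i
    by (cases i) (use c in \<open>auto simp: f_def\<close>)
  have step: "occ_above c z (f x)" if "occ_below c z x" "0 \<le> x" for x
    unfolding f_def using that c z by (intro occ_above_from_below) auto
  show ?thesis
  proof (induction j)
    case 0
    have "occ_below c z 0"
      unfolding occ_below_def using c z
      by (auto intro!: always_eventually tri.occ_ge_nonpos divide_nonpos_nonneg)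
    then show ?case
      using step by simp
  next
    case (Suc j)
    have "occ_below c z (f ((f ^^ (2 * j + 1)) 0))"
      using Suc c z nn[of "2 * j + 1"] occ_below_from_above[of c z "(f ^^ (2 * j + 1)) 0"]
      by (simp add: f_def)
    then have "occ_below c z ((f ^^ (2 * Suc j)) 0)"
      by simp
    then show ?case
      using step[of "(f ^^ (2 * Suc j)) 0"] nn[of "2 * Suc j"] by simp
  qed
qed

lemma edge_marginal:
  fixes b z \<epsilon> :: real
  assumes z: "0 \<le> z" "z \<le> 1" and b: "0 \<le> b" "2 * z * b\<^sup>2 < 1" and \<epsilon>: "0 < \<epsilon>"
  shows "\<forall>\<^sub>F n in sequentially. \<forall>e\<in>edge_slots n.
    \<bar>b * exp (z * b\<^sup>2) * gas (b * exp (z * b\<^sup>2) / sqrt (real n)) z sides (edge_slots n - {e}) {e} (triples n)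
     - b * graph_gas n (b * exp (z * b\<^sup>2) / sqrt (real n)) z\<bar>
    \<le> \<epsilon> * graph_gas n (b * exp (z * b\<^sup>2) / sqrt (real n)) z"
proof -
  define c where "c = b * exp (z * b\<^sup>2)"
  define f where "f = (\<lambda>x. c * exp (- z * x\<^sup>2))"
  define \<kappa> where "\<kappa> = sqrt (2 * z * b\<^sup>2)"
  have \<kappa>: "0 \<le> \<kappa>" "\<kappa> < 1"
    using z b by (auto simp: \<kappa>_def)
  have fb: "f b = b"
    by (simp add: f_def c_def mult.assoc flip: exp_add)
  have dist: "\<bar>(f ^^ i) 0 - b\<bar> \<le> \<kappa> ^ i * b" for i
  proof (induction i)
    case (Suc i)
    have "\<bar>f ((f ^^ i) 0) - f b\<bar> \<le> \<kappa> * \<bar>(f ^^ i) 0 - b\<bar>"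
      using gaussian_map_contraction[OF z(1) b, of "(f ^^ i) 0" b] by (simp add: f_def c_def \<kappa>_def)
    also have "\<dots> \<le> \<kappa> * (\<kappa> ^ i * b)"
      using Suc \<kappa> by (intro mult_left_mono)
    finally show ?case
      using fb by simp
  qed (use b in auto)
  have "(\<lambda>i. \<kappa> ^ i * b) \<longlonglongrightarrow> 0 * b"
    using \<kappa> by (intro tendsto_mult LIMSEQ_power_zero tendsto_const) auto
  then have "\<forall>\<^sub>F i in sequentially. \<kappa> ^ i * b < \<epsilon>"
    using \<epsilon> by (intro order_tendstoD(2)) auto
  then obtain i0 where i0: "\<And>i. i \<ge> i0 \<Longrightarrow> \<kappa> ^ i * b < \<epsilon>"
    by (auto simp: eventually_sequentially)
  have "\<bar>(f ^^ (2 * i0)) 0 - b\<bar> < \<epsilon>" "\<bar>(f ^^ (2 * i0 + 1)) 0 - b\<bar> < \<epsilon>"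
    using dist[of "2 * i0"] dist[of "2 * i0 + 1"] i0[of "2 * i0"] i0[of "2 * i0 + 1"] by linarith+
  \<comment> \<open>Strictness matters: \<open>occ_below\<close> and \<open>occ_above\<close>
    deliver only bounds that are strictly worse than the iterates.\<close>
  then have "b - \<epsilon> < (f ^^ (2 * i0)) 0" "(f ^^ (2 * i0 + 1)) 0 < b + \<epsilon>"
    by linarith+
  moreover have "occ_below c z ((f ^^ (2 * i0)) 0)" "occ_above c z ((f ^^ (2 * i0 + 1)) 0)"
    using occ_iterates[OF z b(1), of i0] unfolding c_def f_def by auto
  ultimately have "\<forall>\<^sub>F n in sequentially. tri.occ_ge n (c / sqrt (real n)) z 0 ((b - \<epsilon>) / sqrt (real n))"
    "\<forall>\<^sub>F n in sequentially. tri.occ_le n (c / sqrt (real n)) z 0 ((b + \<epsilon>) / sqrt (real n))"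
    by (auto simp: occ_below_def occ_above_def)
  then show ?thesis
    unfolding c_def[symmetric] using eventually_gt_at_top[of 0]
  proof eventually_elim
    case (elim n)
    let ?l = "c / sqrt (real n)"
    \<comment> \<open>While nothing is occupied no slot is blocked, so the lower bound holds for
      every slot.\<close>
    have nb: "tri.blocked {} (triples n) = {}"
    proof -
      have "\<not> sides T - {x} \<subseteq> {}" if "T \<in> triples n" for T x
      proof
        assume "sides T - {x} \<subseteq> {}"
        then have "card (sides T) \<le> card {x}"
          by (intro card_mono) auto
        then show False
          using tri.triple_card[OF that] by simp
      qed
      then show ?thesis
        unfolding tri.blocked_def by blast
    qed
    show ?case
    proof
      fix e assume e: "e \<in> edge_slots n"
      let ?G = "gas ?l z sides (edge_slots n - {e}) {e} (triples n)"
      have "(b - \<epsilon>) / sqrt (real n) * graph_gas n ?l z \<le> ?l * ?G"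
        using elim(1) tri.explored_start[of n] e nb unfolding tri.occ_ge_def by auto
      moreover have "?l * ?G \<le> (b + \<epsilon>) / sqrt (real n) * graph_gas n ?l z"
        using elim(2) tri.explored_start[of n] e unfolding tri.occ_le_def by auto
      ultimately have "(b - \<epsilon>) * graph_gas n ?l z \<le> c * ?G" "c * ?G \<le> (b + \<epsilon>) * graph_gas n ?l z"
        using elim(3) by (simp_all add: divide_le_cancel)
      then show "\<bar>c * ?G - b * graph_gas n ?l z\<bar> \<le> \<epsilon> * graph_gas n ?l z"
        by (simp add: abs_le_iff algebra_simps)
    qed
  qed
qed

section \<open>The partition function\<close>

text \<open>Differentiating \<open>l ^ card S\<close> gives one term for each element of
  \<open>S\<close>, and collecting the terms by that element pins it as occupied. Thus the
  logarithmic derivative of the partition function is a sum of slot marginals.\<close>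

lemma gas_has_derivative:
  assumes "finite V"
  shows "((\<lambda>l. gas l z s V A H) has_real_derivative (\<Sum>x\<in>V. gas l z s (V - {x}) (insert x A) H)) (at l)"
  using assms
proof (induction V arbitrary: A rule: finite_induct)
  case empty
  then show ?case
    by (simp add: gas_def)
next
  case (insert x V)
  let ?D = "\<lambda>A. \<Sum>y\<in>V. gas l z s (V - {y}) (insert y A) H"
  have split: "gas l z s (insert x V) B H = gas l z s V B H + l * gas l z s V (insert x B) H" for l B
    using gas_split[of "insert x V" x l z s B H] insert.hyps by simp
  have "((\<lambda>l. gas l z s V A H + l * gas l z s V (insert x A) H) has_real_derivative
      ?D A + (gas l z s V (insert x A) H + l * ?D (insert x A))) (at l)"
    by (auto intro!: derivative_eq_intros insert.IH)
  moreover have "(\<Sum>y\<in>insert x V. gas l z s (insert x V - {y}) (insert y A) H) =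
      ?D A + (gas l z s V (insert x A) H + l * ?D (insert x A))"
  proof -
    have "gas l z s (insert x V - {y}) (insert y A) H =
        gas l z s (V - {y}) (insert y A) H + l * gas l z s (V - {y}) (insert y (insert x A)) H"
      if "y \<in> V" for y
    proof -
      have "insert x V - {y} - {x} = V - {y}"
        using insert.hyps by auto
      then show ?thesis
        using gas_split[of "insert x V - {y}" x l z s "insert y A" H] insert.hyps that
        by (auto simp: insert_commute)
    qed
    moreover have "insert x V - {x} = V"
      using insert.hyps by auto
    ultimately show ?thesis
      using insert.hyps by (simp add: sum.distrib sum_distrib_left)
  qed
  ultimately show ?case
    by (simp add: split)
qed

lemma triangle_count_sides: "triangle_count n G = card {T \<in> triples n. sides T \<subseteq> G}"
proof -
  have "(\<forall>u\<in>T. \<forall>v\<in>T. u \<noteq> v \<longrightarrow> {u, v} \<in> G) \<longleftrightarrow> sides T \<subseteq> G" for T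
  proof
    assume *: "\<forall>u\<in>T. \<forall>v\<in>T. u \<noteq> v \<longrightarrow> {u, v} \<in> G"
    show "sides T \<subseteq> G"
      using * by (auto simp: sides_def card_2_iff)
  next
    assume *: "sides T \<subseteq> G"
    have "{u, v} \<in> sides T" if "u \<in> T" "v \<in> T" "u \<noteq> v" for u v
      using that by (simp add: sides_def)
    then show "\<forall>u\<in>T. \<forall>v\<in>T. u \<noteq> v \<longrightarrow> {u, v} \<in> G"
      using * by blast
  qed
  then show ?thesis
    by (simp add: triangle_count_def triples_def conj_assoc)
qed

lemma sides_nonempty: "T \<in> triples n \<Longrightarrow> sides T \<noteq> {}"
  using tri.triple_card[of T n] by auto

lemma graph_gas_sum:
  "graph_gas n l z = (\<Sum>G\<in>Pow (edge_slots n). l ^ card G * (1 - z) ^ triangle_count n G)"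
  by (simp add: gas_def triangle_count_sides)

lemma triangle_count_empty: "triangle_count n {} = 0"
  using sides_nonempty by (auto simp: triangle_count_sides)

lemma graph_gas_ge_one:
  assumes "0 \<le> l" "z \<le> 1"
  shows "1 \<le> graph_gas n l z"
proof -
  have "(\<Sum>G\<in>{{}}. l ^ card G * (1 - z) ^ triangle_count n G) \<le> graph_gas n l z"
    unfolding graph_gas_sum by (rule sum_mono2) (use assms in auto)
  then show ?thesis
    by (simp add: triangle_count_empty)
qed

lemma graph_gas_zero: "graph_gas n 0 z = 1"
proof -
  have "graph_gas n 0 z = (\<Sum>G\<in>Pow (edge_slots n). if G = {} then 1 else 0)"
    unfolding graph_gas_sum
    by (rule sum.cong) (auto simp: triangle_count_empty power_0_left card_eq_0_iff
        dest: finite_subset[OF _ finite_edge_slots])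
  then show ?thesis
    by simp
qed

lemma card_edge_slots: "card (edge_slots n) = n choose 2"
  using n_subsets[of "{..<n}" 2] by (simp add: edge_slots_def)

lemma real_card_edge_slots: "real (card (edge_slots n)) = real n * (real n - 1) / 2"
  unfolding card_edge_slots by (cases n) (simp_all add: choose_two real_of_nat_div algebra_simps)

text \<open>The origin of the scale \<open>n^(3/2)\<close>: about \<open>n^2 / 2\<close> slots, each
  with weight of order \<open>1 / sqrt n\<close>.\<close>

lemma sqrt_mult_powr: "sqrt (real n) * real n powr (3/2) = (real n)\<^sup>2"
proof (cases "n = 0")
  case False
  then have "sqrt (real n) * real n powr (3/2) = real n powr (1/2) * real n powr (3/2)"
    by (simp add: powr_half_sqrt)
  also have "\<dots> = real n powr 2"
    by (simp flip: powr_add)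
  finally show ?thesis
    using False by (simp add: powr_numeral)
qed auto

lemma card_edge_slots_ratio:
  "(\<lambda>n. real (card (edge_slots n)) / (sqrt (real n) * real n powr (3/2))) \<longlonglongrightarrow> 1 / 2"
proof -
  have "(\<lambda>n. (1 - 1 / real n) / 2) \<longlonglongrightarrow> (1 - 0) / 2"
    by (intro tendsto_intros lim_const_over_n) auto
  moreover have "\<forall>\<^sub>F n in sequentially. (1 - 1 / real n) / 2 =
      real (card (edge_slots n)) / (sqrt (real n) * real n powr (3/2))"
    using eventually_gt_at_top[of 0]
    by eventually_elim (simp add: sqrt_mult_powr real_card_edge_slots field_simps power2_eq_square)
  ultimately show ?thesis
    using Lim_transform_eventually by fastforce
qed

lemma card_edge_slots_ratio_le:
  "real (card (edge_slots n)) / (sqrt (real n) * real n powr (3/2)) \<le> 1"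
proof (cases "n = 0")
  case False
  then show ?thesis
    by (simp add: sqrt_mult_powr real_card_edge_slots field_simps power2_eq_square)
qed auto

text \<open>
  If slots are occupied with probability \<open>b / sqrt n\<close>, then a slot closes \<open>Poisson(b^2)\<close>
  triangles, so the activity has to be \<open>activity b z / sqrt n\<close>.
\<close>

definition activity :: "real \<Rightarrow> real \<Rightarrow> real" where
  "activity b z = b * exp (z * b\<^sup>2)"

lemma activity_nonneg: "0 \<le> b \<Longrightarrow> 0 \<le> activity b z"
  by (simp add: activity_def)

text \<open>The integration runs over the density parameter \<beta> from 0 to \<open>b\<close> at
  fixed \<open>z\<close>, with the activity following it. On this path the slot density is
  asymptotically \<open>\<beta> / sqrt n\<close>, and \<open>2 z \<beta>^2 < 1\<close> persists
  throughout.\<close>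

lemma log_partition:
  assumes z: "0 \<le> z" "z \<le> 1" and b: "0 \<le> b" "2 * z * b\<^sup>2 < 1"
  shows "(\<lambda>n. ln (graph_gas n (activity b z / sqrt (real n)) z) / real n powr (3/2))
    \<longlonglongrightarrow> b / 2 + z * b ^ 3 / 3"
proof -
  define Z where "Z n \<beta> = graph_gas n (activity \<beta> z / sqrt (real n)) z" for n \<beta>
  define M where "M n \<beta> = (\<Sum>e\<in>edge_slots n. gas (activity \<beta> z / sqrt (real n)) z sides
    (edge_slots n - {e}) {e} (triples n))" for n \<beta>
  define r where "r n = real (card (edge_slots n)) / (sqrt (real n) * real n powr (3/2))" for n
  define F where "F n \<beta> = ln (Z n \<beta>) / real n powr (3/2)" for n \<beta>
  define f where "f n \<beta> = M n \<beta> / Z n \<beta> * (exp (z * \<beta>\<^sup>2) * (1 + 2 * z * \<beta>\<^sup>2) /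
    (sqrt (real n) * real n powr (3/2)))" for n \<beta>
  define g where "g \<beta> = (1 + 2 * z * \<beta>\<^sup>2) / 2" for \<beta> :: real
  \<comment> \<open>The limit computed below divides by \<beta>, so the value at 0 is set by hand. A
    single point does not change the integral.\<close>
  define f0 where "f0 n \<beta> = (if \<beta> = 0 then 1/2 else f n \<beta>)" for n \<beta>
  have Z1: "1 \<le> Z n \<beta>" if "0 \<le> \<beta>" for n \<beta>
    using that z by (auto simp: Z_def intro!: graph_gas_ge_one activity_nonneg divide_nonneg_nonneg)
  have M_nonneg: "0 \<le> M n \<beta>" if "0 \<le> \<beta>" for n \<beta>
    using that z by (auto simp: M_def intro!: sum_nonneg gas_nonneg activity_nonneg divide_nonneg_nonneg)
  have deriv: "(F n has_real_derivative f n \<beta>) (at \<beta> within S)" if \<beta>: "0 \<le> \<beta>" for n \<beta> S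
  proof -
    have "((\<lambda>\<beta>. activity \<beta> z / sqrt (real n)) has_real_derivative
        exp (z * \<beta>\<^sup>2) * (1 + 2 * z * \<beta>\<^sup>2) / sqrt (real n)) (at \<beta> within S)"
      unfolding activity_def
      by (rule DERIV_cdivide) (auto intro!: derivative_eq_intros simp: power2_eq_square algebra_simps)
    then have "(Z n has_real_derivative
        M n \<beta> * (exp (z * \<beta>\<^sup>2) * (1 + 2 * z * \<beta>\<^sup>2) / sqrt (real n))) (at \<beta> within S)"
      unfolding Z_def M_def
      by (rule DERIV_chain2[OF gas_has_derivative, rotated]) simp
    then have "(F n has_real_derivative (1 / Z n \<beta> *
        (M n \<beta> * (exp (z * \<beta>\<^sup>2) * (1 + 2 * z * \<beta>\<^sup>2) / sqrt (real n)))) / real n powr (3/2)) (at \<beta> within S)"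
      unfolding F_def using Z1[OF \<beta>, of n]
      by (intro DERIV_cdivide DERIV_chain2[OF DERIV_ln_divide]) auto
    then show ?thesis
      by (simp add: f_def mult.assoc)
  qed
  have F0: "F n 0 = 0" for n
    by (simp add: F_def Z_def activity_def graph_gas_zero)
  have int_f: "(f0 n has_integral F n b) {0..b}" for n
  proof (rule has_integral_spike_finite[of "{0}"])
    have "(f n has_integral (F n b - F n 0)) {0..b}"
      by (rule fundamental_theorem_of_calculus)
        (use b deriv in \<open>auto simp: has_real_derivative_iff_has_vector_derivative[symmetric]\<close>)
    then show "(f n has_integral F n b) {0..b}"
      by (simp add: F0)
  qed (auto simp: f0_def)
  \<comment> \<open>A constant dominating all \<open>n\<close> at once: every marginal sum is at
    most the number of slots times the partition function. The summand 1/2 covers the modified value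
    at 0.\<close>
  have bound: "norm (f0 n \<beta>) \<le> 1 / 2 + exp (z * b\<^sup>2) * (1 + 2 * z * b\<^sup>2)" if "\<beta> \<in> {0..b}" for n \<beta>
  proof -
    have \<beta>: "0 \<le> \<beta>" "\<beta> \<le> b"
      using that by auto
    have Mle: "M n \<beta> \<le> real (card (edge_slots n)) * Z n \<beta>"
      unfolding M_def
    proof (rule sum_bounded_above)
      fix e assume "e \<in> edge_slots n"
      then show "gas (activity \<beta> z / sqrt (real n)) z sides (edge_slots n - {e}) {e} (triples n) \<le> Z n \<beta>"
        unfolding Z_def using z \<beta> tri.gas_occupy_le[OF _ z tri.explored_start, of "activity \<beta> z / sqrt (real n)" e n]
        by (simp add: activity_nonneg)
    qed
    define h where "h = exp (z * \<beta>\<^sup>2) * (1 + 2 * z * \<beta>\<^sup>2)"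
    have h: "0 \<le> h" "h \<le> exp (z * b\<^sup>2) * (1 + 2 * z * b\<^sup>2)"
      using \<beta> z unfolding h_def by (auto intro!: mult_mono mult_left_mono power_mono add_mono add_nonneg_nonneg)
    have pos: "0 \<le> sqrt (real n) * real n powr (3/2)"
      by simp
    have "f n \<beta> = M n \<beta> / Z n \<beta> * (h / (sqrt (real n) * real n powr (3/2)))"
      by (simp add: f_def h_def)
    also have "\<dots> \<le> real (card (edge_slots n)) * (h / (sqrt (real n) * real n powr (3/2)))"
      using Mle Z1[OF \<beta>(1), of n] h by (intro mult_right_mono) (auto simp: divide_le_eq)
    also have "\<dots> = r n * h"
      by (simp add: r_def)
    also have "\<dots> \<le> 1 * h"
      using h card_edge_slots_ratio_le[of n] by (intro mult_right_mono) (auto simp: r_def)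
    finally have "f n \<beta> \<le> exp (z * b\<^sup>2) * (1 + 2 * z * b\<^sup>2)"
      using h by simp
    moreover have "0 \<le> f n \<beta>"
      unfolding f_def using M_nonneg[OF \<beta>(1), of n] Z1[OF \<beta>(1), of n] z by simp
    moreover have "0 \<le> exp (z * b\<^sup>2) * (1 + 2 * z * b\<^sup>2)"
      using h by linarith
    ultimately show ?thesis
      by (simp add: f0_def)
  qed
  have lim: "(\<lambda>n. f0 n \<beta>) \<longlonglongrightarrow> g \<beta>" if "\<beta> \<in> {0..b}" for \<beta>
  proof (cases "\<beta> = 0")
    case False
    then have \<beta>: "0 < \<beta>" "\<beta> \<le> b"
      using that by auto
    have z\<beta>: "2 * z * \<beta>\<^sup>2 < 1"
    proof -
      have "2 * z * \<beta>\<^sup>2 \<le> 2 * z * b\<^sup>2"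
        using \<beta> z by (intro mult_left_mono power_mono) auto
      then show ?thesis
        using b by simp
    qed
    define p where "p n = activity \<beta> z * M n \<beta> / Z n \<beta> / real (card (edge_slots n))" for n
    have "p \<longlonglongrightarrow> \<beta>"
    proof (rule tendstoI)
      fix \<epsilon> :: real assume "0 < \<epsilon>"
      then have "\<forall>\<^sub>F n in sequentially. \<forall>e\<in>edge_slots n.
        \<bar>activity \<beta> z * gas (activity \<beta> z / sqrt (real n)) z sides (edge_slots n - {e}) {e} (triples n)
          - \<beta> * Z n \<beta>\<bar> \<le> \<epsilon> / 2 * Z n \<beta>"
        using edge_marginal[OF z _ z\<beta>, of "\<epsilon> / 2"] \<beta> by (simp add: activity_def Z_def)
      then show "\<forall>\<^sub>F n in sequentially. dist (p n) \<beta> < \<epsilon>"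
        using eventually_gt_at_top[of 1]
      proof eventually_elim
        case (elim n)
        let ?N = "real (card (edge_slots n))"
        have N: "0 < ?N"
          using elim(2) by (simp add: real_card_edge_slots)
        have Zp: "0 < Z n \<beta>"
          using Z1[of \<beta> n] \<beta> by simp
        have "\<bar>activity \<beta> z * M n \<beta> - ?N * (\<beta> * Z n \<beta>)\<bar> =
          \<bar>\<Sum>e\<in>edge_slots n. activity \<beta> z * gas (activity \<beta> z / sqrt (real n)) z sides
            (edge_slots n - {e}) {e} (triples n) - \<beta> * Z n \<beta>\<bar>"
          by (simp add: M_def sum_distrib_left sum_subtractf)
        also have "\<dots> \<le> (\<Sum>e\<in>edge_slots n. \<epsilon> / 2 * Z n \<beta>)"
          by (rule order_trans[OF sum_abs sum_mono]) (use elim(1) in blast)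
        also have "\<dots> = ?N * (\<epsilon> / 2 * Z n \<beta>)"
          by simp
        finally have "\<bar>activity \<beta> z * M n \<beta> - ?N * (\<beta> * Z n \<beta>)\<bar> / (?N * Z n \<beta>) \<le> \<epsilon> / 2"
          using N Zp by (simp add: divide_le_eq mult_ac)
        moreover have "p n - \<beta> = (activity \<beta> z * M n \<beta> - ?N * (\<beta> * Z n \<beta>)) / (?N * Z n \<beta>)"
          unfolding p_def using N Zp by (auto simp: diff_divide_distrib mult_ac)
        then have "\<bar>p n - \<beta>\<bar> = \<bar>activity \<beta> z * M n \<beta> - ?N * (\<beta> * Z n \<beta>)\<bar> / (?N * Z n \<beta>)"
          using Zp by (simp add: abs_divide abs_mult)
        ultimately show ?case
          using \<open>0 < \<epsilon>\<close> unfolding dist_real_def by linarith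
      qed
    qed
    moreover have "r \<longlonglongrightarrow> 1 / 2"
      unfolding r_def by (rule card_edge_slots_ratio)
    \<comment> \<open>The density contributes \<beta>, the logarithmic derivative of the activity
      contributes \<open>(1 + 2 z \<beta>^2) / \<beta>\<close>, and the number of slots contributes
      1/2.\<close>
    ultimately have "(\<lambda>n. p n * r n * ((1 + 2 * z * \<beta>\<^sup>2) / \<beta>)) \<longlonglongrightarrow> \<beta> * (1 / 2) * ((1 + 2 * z * \<beta>\<^sup>2) / \<beta>)"
      by (intro tendsto_mult tendsto_const)
    moreover have "\<forall>\<^sub>F n in sequentially. p n * r n * ((1 + 2 * z * \<beta>\<^sup>2) / \<beta>) = f0 n \<beta>"
      using eventually_gt_at_top[of 1]
    proof eventually_elim
      case (elim n)
      let ?N = "real (card (edge_slots n))"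
      have N: "?N \<noteq> 0"
        using elim by (simp add: real_card_edge_slots)
      have pr: "p n * r n = activity \<beta> z * M n \<beta> / Z n \<beta> / (sqrt (real n) * real n powr (3/2))"
        unfolding p_def r_def using N by simp
      show ?case
        unfolding pr using \<beta> by (simp add: f0_def f_def activity_def)
    qed
    ultimately have "(\<lambda>n. f0 n \<beta>) \<longlonglongrightarrow> \<beta> * (1 / 2) * ((1 + 2 * z * \<beta>\<^sup>2) / \<beta>)"
      by (rule Lim_transform_eventually)
    then show ?thesis
      using \<beta> by (simp add: g_def)
  qed (auto simp: f0_def g_def)
  have "(\<lambda>n. integral {0..b} (f0 n)) \<longlonglongrightarrow> integral {0..b} g"
    by (rule dominated_convergence(2)[where h = "\<lambda>_. 1 / 2 + exp (z * b\<^sup>2) * (1 + 2 * z * b\<^sup>2)"])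
      (use int_f bound lim in auto)
  moreover have "integral {0..b} (f0 n) = F n b" for n
    using int_f by (rule integral_unique)
  moreover have "(g has_integral ((\<lambda>\<beta>. \<beta> / 2 + z * \<beta> ^ 3 / 3) b - (\<lambda>\<beta>. \<beta> / 2 + z * \<beta> ^ 3 / 3) 0)) {0..b}"
    by (rule fundamental_theorem_of_calculus)
      (use b in \<open>auto simp: g_def has_real_derivative_iff_has_vector_derivative[symmetric]
          power2_eq_square intro!: derivative_eq_intros\<close>)
  then have "integral {0..b} g = b / 2 + z * b ^ 3 / 3"
    by (auto dest: integral_unique)
  ultimately show ?thesis
    by (simp add: F_def Z_def)
qed

section \<open>Concentration under the Gibbs measure\<close>

definition gibbs :: "real \<Rightarrow> real \<Rightarrow> nat \<Rightarrow> nat set set \<Rightarrow> real" where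
  "gibbs b z n G = (activity b z / sqrt (real n)) ^ card G * (1 - z) ^ triangle_count n G"

definition gibbs_total :: "real \<Rightarrow> real \<Rightarrow> nat \<Rightarrow> real" where
  "gibbs_total b z n = graph_gas n (activity b z / sqrt (real n)) z"

abbreviation (input) vol :: "nat \<Rightarrow> real" where
  "vol n \<equiv> real n powr (3/2)"

lemma gibbs_total_sum: "gibbs_total b z n = (\<Sum>G\<in>Pow (edge_slots n). gibbs b z n G)"
  by (simp add: gibbs_total_def gibbs_def graph_gas_sum)

lemma gibbs_nonneg: "0 \<le> b \<Longrightarrow> z \<le> 1 \<Longrightarrow> 0 \<le> gibbs b z n G"
  by (simp add: gibbs_def activity_nonneg)

lemma gibbs_total_ge_one: "0 \<le> b \<Longrightarrow> z \<le> 1 \<Longrightarrow> 1 \<le> gibbs_total b z n"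
  by (simp add: gibbs_total_def activity_nonneg graph_gas_ge_one)

lemma filterlim_vol: "filterlim vol at_top sequentially"
  by real_asymp

lemma log_partition_limit:
  assumes "0 \<le> z" "z \<le> 1" "0 \<le> b" "2 * z * b\<^sup>2 < 1"
  shows "(\<lambda>n. ln (gibbs_total b z n) / vol n) \<longlonglongrightarrow> b / 2 + z * b ^ 3 / 3"
  using log_partition[OF assms] by (simp add: gibbs_total_def)

lemma gibbs_tilt:
  assumes "activity b' z' = activity b z * exp t" "1 - z' = (1 - z) * exp s"
  shows "gibbs b' z' n G = gibbs b z n G * exp (t * card G + s * triangle_count n G)"
proof -
  have "gibbs b' z' n G = (activity b z / sqrt (real n) * exp t) ^ card G *
      ((1 - z) * exp s) ^ triangle_count n G"
    unfolding gibbs_def assms by simp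
  then show ?thesis
    by (simp only: gibbs_def power_mult_distrib exp_add exp_of_nat2_mult[symmetric])
      (simp add: mult_ac)
qed

text \<open>Chernoff bound. On the event the tilt gains at least \<open>exp (\<theta> vol)\<close>,
  while the tilted partition function exceeds the original one only by
  \<open>exp (\<phi> vol + o(vol))\<close> with \<phi> < \<theta>.\<close>

lemma gibbs_event_small:
  assumes z: "0 \<le> z" "z \<le> 1" "0 \<le> z'" "z' \<le> 1"
    and b: "0 \<le> b" "2 * z * b\<^sup>2 < 1" "0 \<le> b'" "2 * z' * b'\<^sup>2 < 1"
    and tilt: "activity b' z' = activity b z * exp t" "1 - z' = (1 - z) * exp s"
    and ev: "\<And>n G. G \<in> Ev n \<Longrightarrow> G \<subseteq> edge_slots n \<and> \<theta> * vol n \<le> t * card G + s * triangle_count n G"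
    and \<theta>: "b' / 2 + z' * b' ^ 3 / 3 - (b / 2 + z * b ^ 3 / 3) < \<theta>"
    and \<epsilon>: "0 < \<epsilon>"
  shows "\<forall>\<^sub>F n in sequentially. (\<Sum>G\<in>Ev n. gibbs b z n G) \<le> \<epsilon> * gibbs_total b z n"
proof -
  define \<phi> where "\<phi> = b' / 2 + z' * b' ^ 3 / 3 - (b / 2 + z * b ^ 3 / 3)"
  \<comment> \<open>Half of the gap absorbs the error in the limit; the other half makes the bound
    decay and beat \<epsilon>.\<close>
  define \<gamma> where "\<gamma> = (\<theta> - \<phi>) / 2"
  have \<gamma>: "0 < \<gamma>" "\<phi> < \<theta> - \<gamma>"
    using \<theta> by (auto simp: \<gamma>_def \<phi>_def field_simps)
  have "(\<lambda>n. ln (gibbs_total b' z' n) / vol n - ln (gibbs_total b z n) / vol n) \<longlonglongrightarrow> \<phi>"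
    unfolding \<phi>_def by (intro tendsto_diff log_partition_limit z b)
  then have "\<forall>\<^sub>F n in sequentially. ln (gibbs_total b' z' n) / vol n - ln (gibbs_total b z n) / vol n < \<theta> - \<gamma>"
    using \<gamma> by (intro order_tendstoD(2))
  moreover have "\<forall>\<^sub>F n in sequentially. - ln \<epsilon> / \<gamma> \<le> vol n"
    using filterlim_vol by (auto simp: filterlim_at_top)
  ultimately show ?thesis
    using eventually_gt_at_top[of 0]
  proof eventually_elim
    case (elim n)
    have Z: "0 < gibbs_total b z n" "0 < gibbs_total b' z' n"
      using gibbs_total_ge_one[of b z n] gibbs_total_ge_one[of b' z' n] z b by auto
    have pos: "0 < vol n"
      using elim by simp
    have "ln (gibbs_total b' z' n) - ln (gibbs_total b z n) \<le> (\<theta> - \<gamma>) * vol n"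
      using elim(1) pos by (simp add: divide_less_eq flip: diff_divide_distrib)
    then have "ln (gibbs_total b' z' n) \<le> \<theta> * vol n - \<gamma> * vol n + ln (gibbs_total b z n)"
      by (simp add: algebra_simps)
    moreover have "- ln \<epsilon> \<le> vol n * \<gamma>"
      using elim(2) \<gamma>(1) by (simp only: pos_divide_le_eq)
    then have "- \<gamma> * vol n \<le> ln \<epsilon>"
      by (simp add: mult.commute)
    ultimately have "ln (gibbs_total b' z' n) \<le> \<theta> * vol n + ln \<epsilon> + ln (gibbs_total b z n)"
      by simp
    then have "exp (ln (gibbs_total b' z' n)) \<le> exp (\<theta> * vol n + ln \<epsilon> + ln (gibbs_total b z n))"
      by simp
    then have main: "gibbs_total b' z' n \<le> exp (\<theta> * vol n) * (\<epsilon> * gibbs_total b z n)"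
      using Z \<epsilon> by (simp add: exp_add)
    have fin: "finite (Pow (edge_slots n))"
      by simp
    have "exp (\<theta> * vol n) * (\<Sum>G\<in>Ev n. gibbs b z n G) \<le> (\<Sum>G\<in>Ev n. gibbs b' z' n G)"
      unfolding sum_distrib_left
    proof (rule sum_mono)
      fix G assume "G \<in> Ev n"
      then have "exp (\<theta> * vol n) \<le> exp (t * card G + s * triangle_count n G)"
        using ev by simp
      then have "exp (\<theta> * vol n) * gibbs b z n G \<le>
          exp (t * card G + s * triangle_count n G) * gibbs b z n G"
        using gibbs_nonneg z b by (intro mult_right_mono) auto
      then show "exp (\<theta> * vol n) * gibbs b z n G \<le> gibbs b' z' n G"
        unfolding gibbs_tilt[OF tilt] by (simp only: mult.commute)
    qed
    also have "\<dots> \<le> gibbs_total b' z' n"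
      unfolding gibbs_total_sum using ev gibbs_nonneg z b by (intro sum_mono2 fin) auto
    finally have "exp (\<theta> * vol n) * (\<Sum>G\<in>Ev n. gibbs b z n G) \<le>
        exp (\<theta> * vol n) * (\<epsilon> * gibbs_total b z n)"
      using main by linarith
    then show ?case
      by simp
  qed
qed

section \<open>Tails of the edge count and the triangle count\<close>

lemma eventually_less_right:
  fixes f :: "real \<Rightarrow> real"
  assumes "(f has_real_derivative d) (at a)" "d < 0"
  shows "\<forall>\<^sub>F x in at_right a. f x < f a"
proof -
  obtain e where e: "e > 0" "\<And>h. 0 < h \<Longrightarrow> h < e \<Longrightarrow> f (a + h) < f a"
    using DERIV_neg_dec_right[OF assms] by blast
  have "f x < f a" if "a < x" "x < a + e" for x
    using e(2)[of "x - a"] that by simp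
  then show ?thesis
    using e(1) by (auto simp: eventually_at_right_field intro!: exI[of _ "a + e"])
qed

lemma eventually_less_left:
  fixes f :: "real \<Rightarrow> real"
  assumes "(f has_real_derivative d) (at a)" "0 < d"
  shows "\<forall>\<^sub>F x in at_left a. f x < f a"
proof -
  obtain e where e: "e > 0" "\<And>h. 0 < h \<Longrightarrow> h < e \<Longrightarrow> f (a - h) < f a"
    using DERIV_pos_inc_left[OF assms] by blast
  have "f x < f a" if "x < a" "a - e < x" for x
    using e(2)[of "a - x"] that by simp
  then show ?thesis
    using e(1) by (auto simp: eventually_at_left_field intro!: exI[of _ "a - e"])
qed

text \<open>At fixed \<open>z\<close>, replacing \<open>b\<close> by \<open>b'\<close> is a pure
  tilt in the edge count. The tilt has the sign of \<open>b' - b\<close>, as the activity increases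
  with the density; the product condition on \<open>Ev\<close> thus serves both tails.\<close>

lemma edge_tail_small:
  assumes z: "0 \<le> z" "z \<le> 1" and b: "0 < b" "2 * z * b\<^sup>2 < 1" "0 < b'" "2 * z * b'\<^sup>2 < 1"
    and less: "b' / 2 + z * b' ^ 3 / 3 - y * (ln b' + z * b'\<^sup>2) < b / 2 + z * b ^ 3 / 3 - y * (ln b + z * b\<^sup>2)"
    and ev: "\<And>n G. G \<in> Ev n \<Longrightarrow> G \<subseteq> edge_slots n \<and> 0 \<le> (card G - y * vol n) * (b' - b)"
    and \<epsilon>: "0 < \<epsilon>"
  shows "\<forall>\<^sub>F n in sequentially. (\<Sum>G\<in>Ev n. gibbs b z n G) \<le> \<epsilon> * gibbs_total b z n"
proof -
  define t where "t = (ln b' + z * b'\<^sup>2) - (ln b + z * b\<^sup>2)"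
  have act: "activity b' z = activity b z * exp t"
    using b by (simp add: activity_def t_def exp_add exp_diff)
  have sgn: "0 \<le> x * t" if "0 \<le> x * (b' - b)" for x
  proof -
    have "0 \<le> t" if "b \<le> b'"
    proof -
      have "z * b\<^sup>2 \<le> z * b'\<^sup>2"
        using that z b by (intro mult_left_mono power_mono) auto
      moreover have "ln b \<le> ln b'"
        using that b by simp
      ultimately show ?thesis
        unfolding t_def by linarith
    qed
    moreover have "t \<le> 0" if "b' \<le> b"
    proof -
      have "z * b'\<^sup>2 \<le> z * b\<^sup>2"
        using that z b by (intro mult_left_mono power_mono) auto
      moreover have "ln b' \<le> ln b"
        using that b by simp
      ultimately show ?thesis
        unfolding t_def by linarith
    qed
    ultimately show ?thesis
      using that b by (cases b b' rule: linorder_cases)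
        (auto simp: zero_le_mult_iff t_def)
  qed
  show ?thesis
  proof (rule gibbs_event_small[of z z b b' t 0 Ev "y * t"])
    fix n G assume G: "G \<in> Ev n"
    then have "0 \<le> (card G - y * vol n) * t"
      using ev sgn by blast
    then show "G \<subseteq> edge_slots n \<and> y * t * vol n \<le> t * card G + (0::real) * triangle_count n G"
      using ev[OF G] by (simp add: algebra_simps)
  next
    show "b' / 2 + z * b' ^ 3 / 3 - (b / 2 + z * b ^ 3 / 3) < y * t"
      using less by (simp add: t_def algebra_simps)
  qed (use z b act \<epsilon> in auto)
qed

text \<open>The derivative at the untilted parameter vanishes exactly at \<open>y = b / 2\<close>.
  For any other \<open>y\<close> an arbitrarily small move of \<open>b\<close> is already a strict
  gain, so subcriticality is kept.\<close>

lemma edge_rate_derivative: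
  assumes "0 < b"
  shows "((\<lambda>x. x / 2 + z * x ^ 3 / 3 - y * (ln x + z * x\<^sup>2)) has_real_derivative
    (1 / b + 2 * z * b) * (b / 2 - y)) (at b)"
  using assms by (auto intro!: derivative_eq_intros simp: field_simps power2_eq_square)

lemma many_edges_small:
  assumes z: "0 \<le> z" "z \<le> 1" and b: "0 < b" "2 * z * b\<^sup>2 < 1" and y: "b / 2 < y" and \<epsilon>: "0 < \<epsilon>"
  shows "\<forall>\<^sub>F n in sequentially. (\<Sum>G | G \<subseteq> edge_slots n \<and> y * vol n \<le> card G. gibbs b z n G)
    \<le> \<epsilon> * gibbs_total b z n"
proof -
  have "((\<lambda>x. 2 * z * x\<^sup>2) \<longlongrightarrow> 2 * z * b\<^sup>2) (at_right b)"
    by (intro tendsto_intros)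
  then have "\<forall>\<^sub>F x in at_right b. 2 * z * x\<^sup>2 < 1"
    using b(2) by (rule order_tendstoD)
  moreover have "(1 / b + 2 * z * b) * (b / 2 - y) < 0"
    using z b y by (intro mult_pos_neg add_pos_nonneg) auto
  note eventually_less_right[OF edge_rate_derivative[OF b(1), of z y] this]
  moreover have "\<forall>\<^sub>F x in at_right b. b < x"
    by (rule eventually_at_right_less)
  ultimately have "\<forall>\<^sub>F x in at_right b. 2 * z * x\<^sup>2 < 1 \<and> b < x \<and>
    x / 2 + z * x ^ 3 / 3 - y * (ln x + z * x\<^sup>2) < b / 2 + z * b ^ 3 / 3 - y * (ln b + z * b\<^sup>2)"
    by eventually_elim blast
  then obtain b' where b': "2 * z * b'\<^sup>2 < 1" "b < b'"
    "b' / 2 + z * b' ^ 3 / 3 - y * (ln b' + z * b'\<^sup>2) < b / 2 + z * b ^ 3 / 3 - y * (ln b + z * b\<^sup>2)"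
    using eventually_happens'[OF trivial_limit_at_right_real] by blast
  show ?thesis
    by (rule edge_tail_small[OF z b _ b'(1,3) _ \<epsilon>]) (use b b' in auto)
qed

lemma few_edges_small:
  assumes z: "0 \<le> z" "z \<le> 1" and b: "0 < b" "2 * z * b\<^sup>2 < 1" and y: "y < b / 2" and \<epsilon>: "0 < \<epsilon>"
  shows "\<forall>\<^sub>F n in sequentially. (\<Sum>G | G \<subseteq> edge_slots n \<and> card G \<le> y * vol n. gibbs b z n G)
    \<le> \<epsilon> * gibbs_total b z n"
proof -
  have "((\<lambda>x. 2 * z * x\<^sup>2) \<longlongrightarrow> 2 * z * b\<^sup>2) (at_left b)"
    by (intro tendsto_intros)
  then have "\<forall>\<^sub>F x in at_left b. 2 * z * x\<^sup>2 < 1"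
    using b(2) by (rule order_tendstoD)
  moreover have "(1 / b + 2 * z * b) * (b / 2 - y) > 0"
    using z b y by (intro mult_pos_pos add_pos_nonneg) auto
  note eventually_less_left[OF edge_rate_derivative[OF b(1), of z y] this]
  moreover have "\<forall>\<^sub>F x in at_left b. x \<in> {0<..<b}"
    using b(1) by (rule eventually_at_left_real)
  ultimately have "\<forall>\<^sub>F x in at_left b. 2 * z * x\<^sup>2 < 1 \<and> x \<in> {0<..<b} \<and>
    x / 2 + z * x ^ 3 / 3 - y * (ln x + z * x\<^sup>2) < b / 2 + z * b ^ 3 / 3 - y * (ln b + z * b\<^sup>2)"
    by eventually_elim blast
  then obtain b' where b': "2 * z * b'\<^sup>2 < 1" "b' \<in> {0<..<b}"
    "b' / 2 + z * b' ^ 3 / 3 - y * (ln b' + z * b'\<^sup>2) < b / 2 + z * b ^ 3 / 3 - y * (ln b + z * b\<^sup>2)"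
    using eventually_happens'[OF trivial_limit_at_left_real] by blast
  show ?thesis
    by (rule edge_tail_small[OF z b _ b'(1,3) _ \<epsilon>]) (use b b' in \<open>auto intro!: mult_nonpos_nonpos\<close>)
qed

text \<open>
  Tilting by \<open>exp (s X)\<close> alone would change the edge density; the edge tilt implicit in keeping
  \<open>b\<close> fixed compensates for this.
\<close>

lemma triangle_tail_small:
  assumes z: "0 \<le> z" "z \<le> 1" and b: "0 < b" "2 * z * b\<^sup>2 < 1"
    and s: "(1 - z) * exp s \<le> 1" "2 * (1 - (1 - z) * exp s) * b\<^sup>2 < 1"
    and rate: "0 < s * x - (1 - z) * (exp s - 1) * b ^ 3 / 6 - (1 - z) * \<bar>exp s - 1\<bar> * b\<^sup>2 * \<delta>"
    and ev: "\<And>n G. G \<in> Ev n \<Longrightarrow> G \<subseteq> edge_slots n \<and> \<bar>card G - b / 2 * vol n\<bar> \<le> \<delta> * vol n \<and>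
      0 \<le> s * (triangle_count n G - x * vol n)"
    and \<epsilon>: "0 < \<epsilon>"
  shows "\<forall>\<^sub>F n in sequentially. (\<Sum>G\<in>Ev n. gibbs b z n G) \<le> \<epsilon> * gibbs_total b z n"
proof -
  define z' where "z' = 1 - (1 - z) * exp s"
  define t where "t = - (1 - z) * (exp s - 1) * b\<^sup>2"
  have t: "t = (z' - z) * b\<^sup>2" "\<bar>t\<bar> = (1 - z) * \<bar>exp s - 1\<bar> * b\<^sup>2"
    using z by (simp add: t_def z'_def algebra_simps, simp add: t_def abs_mult)
  have act: "activity b z' = activity b z * exp t"
    unfolding activity_def t(1) by (simp add: mult.assoc algebra_simps flip: exp_add)
  show ?thesis
  proof (rule gibbs_event_small[of z z' b b t s Ev "s * x + t * (b / 2) - \<bar>t\<bar> * \<delta>"])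
    fix n G assume G: "G \<in> Ev n"
    have "\<bar>t * (card G - b / 2 * vol n)\<bar> \<le> \<bar>t\<bar> * (\<delta> * vol n)"
      using ev[OF G] by (simp add: abs_mult mult_left_mono)
    then have "- (\<bar>t\<bar> * (\<delta> * vol n)) \<le> t * (card G - b / 2 * vol n)"
      by linarith
    then show "G \<subseteq> edge_slots n \<and> (s * x + t * (b / 2) - \<bar>t\<bar> * \<delta>) * vol n \<le>
        t * card G + s * triangle_count n G"
      using ev[OF G] by (simp add: algebra_simps)
  next
    have "t * (b / 2) = (z' - z) * b ^ 3 / 3 - (1 - z) * (exp s - 1) * b ^ 3 / 6"
      by (simp add: t(1) z'_def field_simps power2_eq_square power3_eq_cube)
    moreover have "(z' - z) * b ^ 3 / 3 = z' * b ^ 3 / 3 - z * b ^ 3 / 3"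
      by (simp add: left_diff_distrib diff_divide_distrib)
    ultimately show "b / 2 + z' * b ^ 3 / 3 - (b / 2 + z * b ^ 3 / 3) < s * x + t * (b / 2) - \<bar>t\<bar> * \<delta>"
      using rate unfolding t(2) by linarith
  qed (use z b s act \<epsilon> in \<open>auto simp: z'_def\<close>)
qed

lemma triangle_rate_derivative:
  fixes x a :: real
  shows "((\<lambda>s. - (s * x - a * (exp s - 1))) has_real_derivative a - x) (at 0)"
  by (auto intro!: derivative_eq_intros)

text \<open>A small \<open>s > 0\<close> suffices, because the rate vanishes at \<open>s = 0\<close>
  and increases there; \<open>0 < z\<close> keeps \<open>(1 - z) * exp s\<close> below 1. The term
  with \<delta> pays for the edge tilt when the edge count is known only up to
  \<open>\<delta> vol\<close>. For \<open>s > 0\<close> it carries the same factor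
  \<open>exp s - 1\<close> as the main term, so both merge into \<open>a\<close>.\<close>

lemma many_triangles_small:
  assumes z: "0 < z" "z < 1" and b: "0 < b" "2 * z * b\<^sup>2 < 1"
    and x: "(1 - z) * (b ^ 3 / 6 + b\<^sup>2 * \<delta>) < x" and \<epsilon>: "0 < \<epsilon>"
  shows "\<forall>\<^sub>F n in sequentially. (\<Sum>G | G \<subseteq> edge_slots n \<and> \<bar>card G - b / 2 * vol n\<bar> \<le> \<delta> * vol n \<and>
    x * vol n \<le> triangle_count n G. gibbs b z n G) \<le> \<epsilon> * gibbs_total b z n"
proof -
  define a where "a = (1 - z) * (b ^ 3 / 6 + b\<^sup>2 * \<delta>)"
  have "((\<lambda>s. (1 - z) * exp s) \<longlongrightarrow> (1 - z) * exp 0) (at_right 0)"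
    by (intro tendsto_intros)
  then have "\<forall>\<^sub>F s in at_right 0. (1 - z) * exp s < 1"
    by (rule order_tendstoD) (use z in auto)
  moreover have "((\<lambda>s. 2 * (1 - (1 - z) * exp s) * b\<^sup>2) \<longlongrightarrow> 2 * (1 - (1 - z) * exp 0) * b\<^sup>2) (at_right 0)"
    by (intro tendsto_intros)
  then have "\<forall>\<^sub>F s in at_right 0. 2 * (1 - (1 - z) * exp s) * b\<^sup>2 < 1"
    by (rule order_tendstoD) (use b in auto)
  moreover have "\<forall>\<^sub>F s in at_right 0. - (s * x - a * (exp s - 1)) < - (0 * x - a * (exp 0 - 1))"
    by (rule eventually_less_right[OF triangle_rate_derivative]) (use x in \<open>auto simp: a_def\<close>)
  moreover have "\<forall>\<^sub>F s in at_right 0. (0::real) < s"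
    by (rule eventually_at_right_less)
  ultimately have "\<forall>\<^sub>F s in at_right 0. (1 - z) * exp s < 1 \<and> 2 * (1 - (1 - z) * exp s) * b\<^sup>2 < 1 \<and>
    0 < s * x - a * (exp s - 1) \<and> 0 < s"
    by eventually_elim auto
  then obtain s where s: "(1 - z) * exp s < 1" "2 * (1 - (1 - z) * exp s) * b\<^sup>2 < 1"
    "0 < s * x - a * (exp s - 1)" "0 < s"
    using eventually_happens'[OF trivial_limit_at_right_real] by blast
  have "a * (exp s - 1) = (1 - z) * (exp s - 1) * b ^ 3 / 6 + (1 - z) * \<bar>exp s - 1\<bar> * b\<^sup>2 * \<delta>"
    using s(4) by (simp add: a_def algebra_simps)
  then show ?thesis
    using s by (intro triangle_tail_small[OF _ _ b _ s(2) _ _ \<epsilon>, where x = x and \<delta> = \<delta>])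
      (use z in auto)
qed

text \<open>For \<open>s < 0\<close> the absolute value of \<open>exp s - 1\<close> has the opposite
  sign, so the price of the edge window now enters \<open>a\<close> with a minus.\<close>

lemma few_triangles_small:
  assumes z: "0 < z" "z < 1" and b: "0 < b" "2 * z * b\<^sup>2 < 1"
    and x: "x < (1 - z) * (b ^ 3 / 6 - b\<^sup>2 * \<delta>)" and \<epsilon>: "0 < \<epsilon>"
  shows "\<forall>\<^sub>F n in sequentially. (\<Sum>G | G \<subseteq> edge_slots n \<and> \<bar>card G - b / 2 * vol n\<bar> \<le> \<delta> * vol n \<and>
    triangle_count n G \<le> x * vol n. gibbs b z n G) \<le> \<epsilon> * gibbs_total b z n"
proof -
  define a where "a = (1 - z) * (b ^ 3 / 6 - b\<^sup>2 * \<delta>)"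
  have "((\<lambda>s. (1 - z) * exp s) \<longlongrightarrow> (1 - z) * exp 0) (at_left 0)"
    by (intro tendsto_intros)
  then have "\<forall>\<^sub>F s in at_left 0. (1 - z) * exp s < 1"
    by (rule order_tendstoD) (use z in auto)
  moreover have "((\<lambda>s. 2 * (1 - (1 - z) * exp s) * b\<^sup>2) \<longlongrightarrow> 2 * (1 - (1 - z) * exp 0) * b\<^sup>2) (at_left 0)"
    by (intro tendsto_intros)
  then have "\<forall>\<^sub>F s in at_left 0. 2 * (1 - (1 - z) * exp s) * b\<^sup>2 < 1"
    by (rule order_tendstoD) (use b in auto)
  moreover have "\<forall>\<^sub>F s in at_left 0. - (s * x - a * (exp s - 1)) < - (0 * x - a * (exp 0 - 1))"
    by (rule eventually_less_left[OF triangle_rate_derivative]) (use x in \<open>auto simp: a_def\<close>)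
  moreover have "\<forall>\<^sub>F s in at_left 0. s \<in> {-1<..<0::real}"
    by (rule eventually_at_left_real) auto
  ultimately have "\<forall>\<^sub>F s in at_left 0. (1 - z) * exp s < 1 \<and> 2 * (1 - (1 - z) * exp s) * b\<^sup>2 < 1 \<and>
    0 < s * x - a * (exp s - 1) \<and> s < 0"
    by eventually_elim auto
  then obtain s where s: "(1 - z) * exp s < 1" "2 * (1 - (1 - z) * exp s) * b\<^sup>2 < 1"
    "0 < s * x - a * (exp s - 1)" "s < 0"
    using eventually_happens'[OF trivial_limit_at_left_real] by blast
  have "a * (exp s - 1) = (1 - z) * (exp s - 1) * b ^ 3 / 6 + (1 - z) * \<bar>exp s - 1\<bar> * b\<^sup>2 * \<delta>"
    using s(4) by (simp add: a_def algebra_simps)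
  then show ?thesis
    using s by (intro triangle_tail_small[OF _ _ b _ s(2) _ _ \<epsilon>, where x = x and \<delta> = \<delta>])
      (use z in \<open>auto intro!: mult_nonpos_nonpos\<close>)
qed

text \<open>Triangles are constrained only for \<open>0 < z < 1\<close>. At \<open>z = 1\<close> a
  graph with a triangle has weight 0 anyway, and \<open>z = 0\<close> serves as a reference measure
  for edge counts.\<close>

definition typical :: "real \<Rightarrow> real \<Rightarrow> real \<Rightarrow> nat \<Rightarrow> nat set set set" where
  "typical b z \<delta> n = {G. G \<subseteq> edge_slots n \<and> \<bar>card G - b / 2 * vol n\<bar> \<le> \<delta> * vol n \<and>
     (0 < z \<and> z < 1 \<longrightarrow> \<bar>triangle_count n G - (1 - z) * b ^ 3 / 6 * vol n\<bar> \<le> \<delta> * vol n)}"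

text \<open>Four exceptional sets of at most an eighth of the mass each leave at least half.\<close>

lemma typical_mass:
  assumes z: "0 \<le> z" "z \<le> 1" and b: "0 < b" "2 * z * b\<^sup>2 < 1" and \<delta>: "0 < \<delta>"
  shows "\<forall>\<^sub>F n in sequentially. gibbs_total b z n / 2 \<le> (\<Sum>G\<in>typical b z \<delta> n. gibbs b z n G)"
proof -
  \<comment> \<open>The triangle tails lose up to \<open>b^2 * \<delta>'\<close> through the edge
    window, so this window is narrowed until the loss is below \<delta>.\<close>
  define \<delta>' where "\<delta>' = min \<delta> (\<delta> / (2 * b\<^sup>2))"
  have \<delta>': "0 < \<delta>'" "\<delta>' \<le> \<delta>" "b\<^sup>2 * \<delta>' < \<delta>"
  proof -
    have "b\<^sup>2 * \<delta>' \<le> b\<^sup>2 * (\<delta> / (2 * b\<^sup>2))"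
      unfolding \<delta>'_def by (intro mult_left_mono) auto
    also have "\<dots> < \<delta>"
      using b \<delta> by simp
    finally show "b\<^sup>2 * \<delta>' < \<delta>" .
  qed (use b \<delta> in \<open>auto simp: \<delta>'_def\<close>)
  define \<mu> where "\<mu> = (1 - z) * b ^ 3 / 6"
  define A1 where "A1 n = {G. G \<subseteq> edge_slots n \<and> (b / 2 + \<delta>') * vol n \<le> card G}" for n
  define A2 where "A2 n = {G. G \<subseteq> edge_slots n \<and> card G \<le> (b / 2 - \<delta>') * vol n}" for n
  define A3 where "A3 n = (if 0 < z \<and> z < 1 then {G. G \<subseteq> edge_slots n \<and>
    \<bar>card G - b / 2 * vol n\<bar> \<le> \<delta>' * vol n \<and> (\<mu> + \<delta>) * vol n \<le> triangle_count n G} else {})" for n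
  define A4 where "A4 n = (if 0 < z \<and> z < 1 then {G. G \<subseteq> edge_slots n \<and>
    \<bar>card G - b / 2 * vol n\<bar> \<le> \<delta>' * vol n \<and> triangle_count n G \<le> (\<mu> - \<delta>) * vol n} else {})" for n
  have "\<forall>\<^sub>F n in sequentially. sum (gibbs b z n) (A1 n) \<le> 1 / 8 * gibbs_total b z n"
    unfolding A1_def by (rule many_edges_small[OF z b]) (use \<delta>' in auto)
  moreover have "\<forall>\<^sub>F n in sequentially. sum (gibbs b z n) (A2 n) \<le> 1 / 8 * gibbs_total b z n"
    unfolding A2_def by (rule few_edges_small[OF z b]) (use \<delta>' in auto)
  moreover have zb: "(1 - z) * (b\<^sup>2 * \<delta>') < \<delta>" if "0 < z"
  proof -
    have "(1 - z) * (b\<^sup>2 * \<delta>') \<le> 1 * (b\<^sup>2 * \<delta>')"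
      using that \<delta>' by (intro mult_right_mono) auto
    then show ?thesis
      using \<delta>' by simp
  qed
  have "\<forall>\<^sub>F n in sequentially. sum (gibbs b z n) (A3 n) \<le> 1 / 8 * gibbs_total b z n"
  proof (cases "0 < z \<and> z < 1")
    case True
    then have "(1 - z) * (b ^ 3 / 6 + b\<^sup>2 * \<delta>') < \<mu> + \<delta>"
      using zb by (simp add: \<mu>_def distrib_left)
    with True show ?thesis
      unfolding A3_def if_P[OF True] by (intro many_triangles_small b) auto
  qed (use z b in \<open>auto simp: A3_def intro!: always_eventually order_trans[OF _ gibbs_total_ge_one]\<close>)
  moreover have "\<forall>\<^sub>F n in sequentially. sum (gibbs b z n) (A4 n) \<le> 1 / 8 * gibbs_total b z n"
  proof (cases "0 < z \<and> z < 1")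
    case True
    then have "\<mu> - \<delta> < (1 - z) * (b ^ 3 / 6 - b\<^sup>2 * \<delta>')"
      using zb by (simp add: \<mu>_def right_diff_distrib)
    with True show ?thesis
      unfolding A4_def if_P[OF True] by (intro few_triangles_small b) auto
  qed (use z b in \<open>auto simp: A4_def intro!: always_eventually order_trans[OF _ gibbs_total_ge_one]\<close>)
  ultimately show ?thesis
  proof eventually_elim
    case (elim n)
    let ?w = "gibbs b z n" and ?T = "typical b z \<delta> n"
    have w: "0 \<le> ?w G" for G
      using gibbs_nonneg z b by simp
    have fin: "finite X" if "X \<subseteq> Pow (edge_slots n)" for X
      using that by (rule finite_subset) simp
    have fins: "finite ?T" "finite (A1 n)" "finite (A2 n)" "finite (A3 n)" "finite (A4 n)"
      by (rule fin; auto simp: typical_def A1_def A2_def A3_def A4_def)+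
    have "Pow (edge_slots n) \<subseteq> ?T \<union> (A1 n \<union> (A2 n \<union> (A3 n \<union> A4 n)))"
    proof
      fix G assume G: "G \<in> Pow (edge_slots n)"
      have "\<delta>' * vol n \<le> \<delta> * vol n"
        using \<delta>' by (intro mult_right_mono) auto
      then show "G \<in> ?T \<union> (A1 n \<union> (A2 n \<union> (A3 n \<union> A4 n)))"
        using G by (auto simp: typical_def A1_def A2_def A3_def A4_def \<mu>_def
            abs_le_iff algebra_simps not_le)
    qed
    then have "gibbs_total b z n \<le> sum ?w (?T \<union> (A1 n \<union> (A2 n \<union> (A3 n \<union> A4 n))))"
      unfolding gibbs_total_sum using fins w by (intro sum_mono2) auto
    also have "\<dots> \<le> sum ?w ?T + (sum ?w (A1 n) + (sum ?w (A2 n) + (sum ?w (A3 n) + sum ?w (A4 n))))"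
    proof -
      have sub: "sum ?w (X \<union> Y) \<le> sum ?w X + sum ?w Y" if "finite X" "finite Y" for X Y
        using sum.union_inter[OF that, of ?w] sum_nonneg[of "X \<inter> Y" ?w, OF w] by linarith
      show ?thesis
        using fins by (intro order_trans[OF sub] add_left_mono) auto
    qed
    finally show ?case
      using elim by linarith
  qed
qed

section \<open>Fixing the number of edges\<close>

definition level_density :: "'a set \<Rightarrow> 'a set set \<Rightarrow> nat \<Rightarrow> real" where
  "level_density \<Omega> D M = card {G \<in> D. card G = M} / (card \<Omega> choose M)"

lemma level_density_nonneg: "0 \<le> level_density \<Omega> D M"
  by (simp add: level_density_def)

text \<open>Double counting of deletions: a member of \<open>D\<close> of size \<open>M + 1\<close>
  allows \<open>M + 1\<close> of them, and a member of size \<open>M\<close> arises from at most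
  \<open>card \<Omega> - M\<close>. The quotient is that of the two binomial coefficients.\<close>

lemma level_density_antimono:
  assumes fin: "finite \<Omega>" and D: "D \<subseteq> Pow \<Omega>" and down: "\<And>G e. G \<in> D \<Longrightarrow> e \<in> G \<Longrightarrow> G - {e} \<in> D"
    and le: "M \<le> M'"
  shows "level_density \<Omega> D M' \<le> level_density \<Omega> D M"
  using le
proof (induction rule: dec_induct)
  case (step M)
  let ?D = "\<lambda>M. {G \<in> D. card G = M}"
  have finD: "finite (?D M)" for M
    using D fin by (auto intro: finite_subset)
  have finG: "finite G" if "G \<in> D" for G
    using that D fin by (auto intro: finite_subset)
  have "level_density \<Omega> D (Suc M) \<le> level_density \<Omega> D M"
  proof (cases "M < card \<Omega>")
    case False
    have "?D (Suc M) = {}"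
    proof (rule ccontr)
      assume "?D (Suc M) \<noteq> {}"
      then obtain G where "G \<subseteq> \<Omega>" "card G = Suc M"
        using D by blast
      then show False
        using False card_mono[OF fin, of G] by simp
    qed
    then have "level_density \<Omega> D (Suc M) = 0"
      unfolding level_density_def by (simp only: card.empty of_nat_0 div_0)
    then show ?thesis
      by (simp add: level_density_nonneg)
  next
    case True
    have "card (SIGMA G:?D (Suc M). G) \<le> card (SIGMA G:?D M. \<Omega> - G)"
    proof (rule card_inj_on_le)
      show "inj_on (\<lambda>(G, e). (G - {e}, e)) (SIGMA G:?D (Suc M). G)"
        by (auto simp: inj_on_def)
      show "(\<lambda>(G, e). (G - {e}, e)) ` (SIGMA G:?D (Suc M). G) \<subseteq> (SIGMA G:?D M. \<Omega> - G)"
        using D down finG by auto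
    qed (use finD fin in auto)
    moreover have "card (SIGMA G:?D (Suc M). G) = card (?D (Suc M)) * Suc M"
      using finD finG by (subst card_SigmaI) auto
    moreover have "card (SIGMA G:?D M. \<Omega> - G) = card (?D M) * (card \<Omega> - M)"
    proof -
      have "card (\<Omega> - G) = card \<Omega> - M" if "G \<in> ?D M" for G
        using that D finG by (subst card_Diff_subset) auto
      then show ?thesis
        using finD fin by (subst card_SigmaI) auto
    qed
    ultimately have "card (?D (Suc M)) * Suc M \<le> card (?D M) * (card \<Omega> - M)"
      by simp
    then have "real (card (?D (Suc M)) * Suc M) \<le> real (card (?D M) * (card \<Omega> - M))"
      by (simp only: of_nat_le_iff)
    then have "real (card (?D (Suc M))) * real (Suc M) * real (card \<Omega> choose M) \<le>
        real (card (?D M)) * real (card \<Omega> - M) * real (card \<Omega> choose M)"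
      by (intro mult_right_mono) (simp_all only: of_nat_mult of_nat_0_le_iff)
    also have "real (card (?D M)) * real (card \<Omega> - M) * real (card \<Omega> choose M) =
        real (card (?D M)) * (real (Suc M) * real (card \<Omega> choose Suc M))"
    proof -
      have "(card \<Omega> - M) * (card \<Omega> choose M) = Suc M * (card \<Omega> choose Suc M)"
        by (simp only: binomial_absorb_comp binomial_absorption)
      then have "real (card \<Omega> - M) * real (card \<Omega> choose M) = real (Suc M) * real (card \<Omega> choose Suc M)"
        by (simp only: of_nat_mult[symmetric])
      then show ?thesis
        by (simp only: mult.assoc)
    qed
    finally have "real (Suc M) * (real (card (?D (Suc M))) * real (card \<Omega> choose M)) \<le>
        real (Suc M) * (real (card (?D M)) * real (card \<Omega> choose Suc M))"
      by (simp only: mult_ac)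
    then have "real (card (?D (Suc M))) * real (card \<Omega> choose M) \<le>
        real (card (?D M)) * real (card \<Omega> choose Suc M)"
      by (simp only: mult_le_cancel_left_pos of_nat_0_less_iff zero_less_Suc)
    then show ?thesis
      using True by (simp add: level_density_def frac_le_eq divide_le_eq le_divide_eq mult.commute)
  qed
  with step.IH show ?case
    by linarith
qed simp

lemma sum_card_levels:
  assumes "finite \<Omega>" "D \<subseteq> Pow \<Omega>"
  shows "(\<Sum>G | G \<in> D \<and> P (card G). h (card G)) =
    (\<Sum>M | M \<le> card \<Omega> \<and> P M. h M * (level_density \<Omega> D M * real (card \<Omega> choose M)))"
proof -
  have finD: "finite D"
    using assms finite_subset by auto
  have "(\<Sum>G | G \<in> D \<and> P (card G). h (card G)) =
      (\<Sum>M | M \<le> card \<Omega> \<and> P M. \<Sum>G | G \<in> {G \<in> D. P (card G)} \<and> card G = M. h (card G))"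
    by (rule sum.group[symmetric]) (use assms finD in \<open>auto intro: card_mono\<close>)
  also have "\<dots> = (\<Sum>M | M \<le> card \<Omega> \<and> P M. h M * (level_density \<Omega> D M * real (card \<Omega> choose M)))"
  proof (rule sum.cong[OF refl])
    fix M assume M: "M \<in> {M. M \<le> card \<Omega> \<and> P M}"
    then have "{G. G \<in> {G \<in> D. P (card G)} \<and> card G = M} = {G \<in> D. card G = M}"
      by auto
    then have "(\<Sum>G | G \<in> {G \<in> D. P (card G)} \<and> card G = M. h (card G)) =
        (\<Sum>G | G \<in> D \<and> card G = M. h M)"
      by (intro sum.cong) auto
    also have "\<dots> = h M * real (card {G \<in> D. card G = M})"
      by simp
    finally show "(\<Sum>G | G \<in> {G \<in> D. P (card G)} \<and> card G = M. h (card G)) =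
        h M * (level_density \<Omega> D M * real (card \<Omega> choose M))"
      using M by (simp add: level_density_def)
  qed
  finally show ?thesis .
qed

lemma level_density_Pow: "finite \<Omega> \<Longrightarrow> M \<le> card \<Omega> \<Longrightarrow> level_density \<Omega> (Pow \<Omega>) M = 1"
  using n_subsets[of \<Omega> M] by (simp add: level_density_def)

context
  fixes \<Omega> :: "'a set" and D and l :: real
  assumes fin: "finite \<Omega>" and D: "D \<subseteq> Pow \<Omega>"
    and down: "\<And>G e. G \<in> D \<Longrightarrow> e \<in> G \<Longrightarrow> G - {e} \<in> D" and l: "0 \<le> l"
begin

text \<open>Bounds the density at level \<open>m\<close> from below by the weight of
  \<open>D\<close> at and above this level.\<close>

lemma upper_levels_le:
  "(\<Sum>G | G \<in> D \<and> m \<le> card G. l ^ card G) \<le> level_density \<Omega> D m * (1 + l) ^ card \<Omega>"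
proof -
  have "(\<Sum>G | G \<in> D \<and> m \<le> card G. l ^ card G) =
      (\<Sum>M | M \<le> card \<Omega> \<and> m \<le> M. l ^ M * (level_density \<Omega> D M * real (card \<Omega> choose M)))"
    by (rule sum_card_levels[OF fin D])
  also have "\<dots> \<le> (\<Sum>M | M \<le> card \<Omega> \<and> m \<le> M. l ^ M * (level_density \<Omega> D m * real (card \<Omega> choose M)))"
    using l by (intro sum_mono mult_left_mono mult_right_mono level_density_antimono[OF fin D down]) auto
  also have "\<dots> \<le> (\<Sum>M\<le>card \<Omega>. l ^ M * (level_density \<Omega> D m * real (card \<Omega> choose M)))"
    using l level_density_nonneg[of \<Omega> D m] by (intro sum_mono2) auto
  also have "\<dots> = level_density \<Omega> D m * (l + 1) ^ card \<Omega>"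
    by (subst binomial_ring) (simp add: sum_distrib_left mult_ac)
  finally show ?thesis
    by (simp add: add.commute)
qed

text \<open>Bounds the density at level \<open>m\<close> from above by comparing \<open>D\<close>
  with all sets of size at most \<open>m\<close>.\<close>

lemma lower_levels_ge:
  "level_density \<Omega> D m * (\<Sum>G | G \<subseteq> \<Omega> \<and> card G \<le> m. l ^ card G) \<le> (\<Sum>G\<in>D. l ^ card G)"
proof -
  have "(\<Sum>G | G \<subseteq> \<Omega> \<and> card G \<le> m. l ^ card G) =
      (\<Sum>M | M \<le> card \<Omega> \<and> M \<le> m. l ^ M * (level_density \<Omega> (Pow \<Omega>) M * real (card \<Omega> choose M)))"
    using sum_card_levels[OF fin order_refl, where P = "\<lambda>M. M \<le> m" and h = "\<lambda>M. l ^ M"] by simp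
  also have "\<dots> = (\<Sum>M | M \<le> card \<Omega> \<and> M \<le> m. l ^ M * real (card \<Omega> choose M))"
    using fin by (intro sum.cong) (auto simp: level_density_Pow)
  finally have "level_density \<Omega> D m * (\<Sum>G | G \<subseteq> \<Omega> \<and> card G \<le> m. l ^ card G) =
      (\<Sum>M | M \<le> card \<Omega> \<and> M \<le> m. l ^ M * (level_density \<Omega> D m * real (card \<Omega> choose M)))"
    by (simp add: sum_distrib_left mult_ac)
  also have "\<dots> \<le> (\<Sum>M | M \<le> card \<Omega> \<and> M \<le> m. l ^ M * (level_density \<Omega> D M * real (card \<Omega> choose M)))"
    using l by (intro sum_mono mult_left_mono mult_right_mono level_density_antimono[OF fin D down]) auto
  also have "\<dots> = (\<Sum>G | G \<in> D \<and> card G \<le> m. l ^ card G)"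
    by (rule sum_card_levels[OF fin D, symmetric])
  also have "\<dots> \<le> (\<Sum>G\<in>D. l ^ card G)"
    using l finite_subset[OF D] fin by (intro sum_mono2) auto
  finally show ?thesis .
qed

end

section \<open>Graphs with few triangles in the uniform model\<close>

definition sparse :: "nat \<Rightarrow> real \<Rightarrow> nat set set set" where
  "sparse n x = {G. G \<subseteq> edge_slots n \<and> real (triangle_count n G) \<le> x}"

lemma sparse_subset: "sparse n x \<subseteq> Pow (edge_slots n)"
  by (auto simp: sparse_def)

lemma sparse_down: "G \<in> sparse n x \<Longrightarrow> G - {e} \<in> sparse n x"
proof -
  assume G: "G \<in> sparse n x"
  have "triangle_count n (G - {e}) \<le> triangle_count n G"
    unfolding triangle_count_sides by (intro card_mono) auto
  then show ?thesis
    using G by (auto simp: sparse_def)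
qed

lemma finite_graphs [simp]: "finite (graphs_with_edges n M)"
  by (rule finite_subset[of _ "Pow (edge_slots n)"]) (auto simp: graphs_with_edges_def)

lemma card_graphs: "card (graphs_with_edges n M) = card (edge_slots n) choose M"
  unfolding graphs_with_edges_def by (simp add: n_subsets)

lemma graphs_nonempty: "M \<le> card (edge_slots n) \<Longrightarrow> graphs_with_edges n M \<noteq> {}"
  using card_graphs[of n M] by (metis card.empty zero_less_binomial_iff less_irrefl)

lemma prob_sparse:
  assumes "M \<le> card (edge_slots n)"
  shows "measure_pmf.prob (random_graph n M) {G. real (triangle_count n G) \<le> x} =
    level_density (edge_slots n) (sparse n x) M"
proof -
  have "graphs_with_edges n M \<inter> {G. real (triangle_count n G) \<le> x} = {G \<in> sparse n x. card G = M}"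
    by (auto simp: graphs_with_edges_def sparse_def)
  then show ?thesis
    using graphs_nonempty[OF assms]
    by (simp add: random_graph_def measure_pmf_of_set level_density_def card_graphs)
qed

section \<open>The mean number of triangles\<close>

lemma card_supersets:
  assumes "finite \<Omega>" "B \<subseteq> \<Omega>" "card B \<le> M"
  shows "card {G. G \<subseteq> \<Omega> \<and> card G = M \<and> B \<subseteq> G} = (card \<Omega> - card B) choose (M - card B)"
proof -
  have finB: "finite B"
    using assms finite_subset by blast
  have "bij_betw (\<lambda>G. B \<union> G) {G. G \<subseteq> \<Omega> - B \<and> card G = M - card B} {G. G \<subseteq> \<Omega> \<and> card G = M \<and> B \<subseteq> G}"
  proof (rule bij_betw_byWitness[where f' = "\<lambda>G. G - B"])
    show "(\<lambda>G. B \<union> G) ` {G. G \<subseteq> \<Omega> - B \<and> card G = M - card B} \<subseteq> {G. G \<subseteq> \<Omega> \<and> card G = M \<and> B \<subseteq> G}"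
    proof (intro image_subsetI CollectI conjI)
      fix G assume G: "G \<in> {G. G \<subseteq> \<Omega> - B \<and> card G = M - card B}"
      then have "finite G"
        using assms finite_subset by blast
      then have "card (B \<union> G) = card B + card G"
        using G finB by (intro card_Un_disjoint) auto
      then show "card (B \<union> G) = M"
        using G assms by simp
    qed (use assms in auto)
    show "(\<lambda>G. G - B) ` {G. G \<subseteq> \<Omega> \<and> card G = M \<and> B \<subseteq> G} \<subseteq> {G. G \<subseteq> \<Omega> - B \<and> card G = M - card B}"
      using finB by (auto simp: card_Diff_subset)
  qed auto
  then have "card {G. G \<subseteq> \<Omega> \<and> card G = M \<and> B \<subseteq> G} = card {G. G \<subseteq> \<Omega> - B \<and> card G = M - card B}"
    by (simp add: bij_betw_same_card)
  also have "\<dots> = card (\<Omega> - B) choose (M - card B)"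
    using assms by (intro n_subsets) auto
  finally show ?thesis
    using assms finB by (simp add: card_Diff_subset)
qed

text \<open>Linearity of expectation. The quotient of binomials for a fixed triple of edges is
  rewritten by \<open>choose_mult\<close>, so that the asymptotics only involve three cubic
  polynomials.\<close>

lemma expectation_triangles:
  assumes "M \<le> card (edge_slots n)" "3 \<le> M"
  shows "measure_pmf.expectation (random_graph n M) (\<lambda>G. real (triangle_count n G)) =
    real (n choose 3) * real (M choose 3) / real (card (edge_slots n) choose 3)"
proof -
  let ?N = "card (edge_slots n)"
  have "(\<Sum>G\<in>graphs_with_edges n M. triangle_count n G) =
      (\<Sum>G\<in>graphs_with_edges n M. \<Sum>T\<in>triples n. if sides T \<subseteq> G then 1 else 0)"
    by (rule sum.cong) (auto simp: triangle_count_sides sum.If_cases Int_def)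
  also have "\<dots> = (\<Sum>T\<in>triples n. \<Sum>G\<in>graphs_with_edges n M. if sides T \<subseteq> G then 1 else 0)"
    by (rule sum.swap)
  also have "\<dots> = (\<Sum>T\<in>triples n. (?N - 3) choose (M - 3))"
  proof (rule sum.cong[OF refl])
    fix T assume T: "T \<in> triples n"
    have "(\<Sum>G\<in>graphs_with_edges n M. if sides T \<subseteq> G then 1 else 0) =
        card {G. G \<subseteq> edge_slots n \<and> card G = M \<and> sides T \<subseteq> G}"
      by (simp add: sum.If_cases graphs_with_edges_def Int_def conj_assoc)
    also have "\<dots> = (?N - 3) choose (M - 3)"
      using card_supersets[of "edge_slots n" "sides T" M] tri.triple_card[OF T] tri.triple_subset[OF T] assms
      by simp
    finally show "(\<Sum>G\<in>graphs_with_edges n M. if sides T \<subseteq> G then 1 else 0) = (?N - 3) choose (M - 3)" .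
  qed
  also have "\<dots> = (n choose 3) * ((?N - 3) choose (M - 3))"
    using n_subsets[of "{..<n}" 3] by (simp add: triples_def)
  finally have sum: "(\<Sum>G\<in>graphs_with_edges n M. real (triangle_count n G)) =
      real (n choose 3) * real ((?N - 3) choose (M - 3))"
    by (simp flip: of_nat_sum of_nat_mult)
  have expect: "measure_pmf.expectation (random_graph n M) (\<lambda>G. real (triangle_count n G)) =
      real (n choose 3) * real ((?N - 3) choose (M - 3)) / real (?N choose M)"
    using graphs_nonempty[OF assms(1)]
    by (simp add: random_graph_def integral_pmf_of_set sum card_graphs)
  have "real (?N choose M) * real (M choose 3) = real (?N choose 3) * real ((?N - 3) choose (M - 3))"
    using choose_mult[OF assms(2,1)] by (metis of_nat_mult)
  moreover have "real (?N choose M) \<noteq> 0" "real (?N choose 3) \<noteq> 0"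
    using assms by auto
  ultimately have "real ((?N - 3) choose (M - 3)) / real (?N choose M) = real (M choose 3) / real (?N choose 3)"
    by (subst frac_eq_eq) (simp_all only: mult.commute not_False_eq_True)
  with expect show ?thesis
    by (simp only: times_divide_eq_right[symmetric])
qed

lemma real_choose_3: "real (k choose 3) = real k * (real k - 1) * (real k - 2) / 6"
proof (induction k)
  case (Suc k)
  have "Suc k choose 3 = (k choose 2) + (k choose 3)"
    by (simp add: numeral_3_eq_3 numeral_2_eq_2)
  moreover have "real (k choose 2) = real k * (real k - 1) / 2"
    by (cases k) (simp_all add: choose_two real_of_nat_div algebra_simps)
  ultimately show ?case
    using Suc by (simp add: field_simps)
qed simp

lemma choose_3_limit:
  assumes "(\<lambda>n. real (a n) / g n) \<longlonglongrightarrow> \<alpha>" "filterlim g at_top sequentially"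
  shows "(\<lambda>n. real (a n choose 3) / g n ^ 3) \<longlonglongrightarrow> \<alpha> ^ 3 / 6"
proof -
  have inv: "(\<lambda>n. c / g n) \<longlonglongrightarrow> 0" for c
    by (intro tendsto_divide_0[OF tendsto_const] filterlim_at_top_imp_at_infinity assms)
  have "(\<lambda>n. real (a n) / g n * (real (a n) / g n - 1 / g n) * (real (a n) / g n - 2 / g n) / 6)
      \<longlonglongrightarrow> \<alpha> * (\<alpha> - 0) * (\<alpha> - 0) / 6"
    by (intro tendsto_intros assms inv) auto
  moreover have "(\<lambda>n. real (a n) / g n * (real (a n) / g n - 1 / g n) * (real (a n) / g n - 2 / g n) / 6) =
      (\<lambda>n. real (a n choose 3) / g n ^ 3)"
    by (simp add: real_choose_3 power3_eq_cube diff_divide_distrib[symmetric] mult_ac)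
  ultimately show ?thesis
    by (simp add: power3_eq_cube)
qed

lemma slots_over_square: "(\<lambda>n. real (card (edge_slots n)) / (real n)\<^sup>2) \<longlonglongrightarrow> 1 / 2"
  using card_edge_slots_ratio by (simp add: sqrt_mult_powr)

lemma eventually_le_slots:
  assumes "(\<lambda>n. real (m n) / vol n) \<longlonglongrightarrow> b / 2"
  shows "\<forall>\<^sub>F n in sequentially. m n \<le> card (edge_slots n)"
proof -
  have "(\<lambda>n. real (m n) / vol n * (1 / sqrt (real n))) \<longlonglongrightarrow> b / 2 * 0"
    by (intro tendsto_mult assms tendsto_over_sqrt)
  then have "\<forall>\<^sub>F n in sequentially. real (m n) / vol n * (1 / sqrt (real n)) < 1 / 4"
    by (rule order_tendstoD) auto
  moreover have "\<forall>\<^sub>F n in sequentially. 1 / 4 < real (card (edge_slots n)) / (real n)\<^sup>2"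
    by (rule order_tendstoD[OF slots_over_square]) auto
  ultimately show ?thesis
    using eventually_gt_at_top[of 0]
  proof eventually_elim
    case (elim n)
    have "real (m n) / vol n * (1 / sqrt (real n)) = real (m n) / (real n)\<^sup>2"
      by (simp add: mult.commute flip: sqrt_mult_powr)
    then have "real (m n) / (real n)\<^sup>2 < real (card (edge_slots n)) / (real n)\<^sup>2"
      using elim by linarith
    then show ?case
      using elim by (simp add: divide_less_cancel)
  qed
qed

lemma expectation_limit:
  assumes b: "0 < b" and m: "(\<lambda>n. real (m n) / vol n) \<longlonglongrightarrow> b / 2"
  shows "(\<lambda>n. measure_pmf.expectation (random_graph n (m n)) (\<lambda>G. real (triangle_count n G)) / vol n)
    \<longlonglongrightarrow> b ^ 3 / 6"
proof -
  have sq: "filterlim (\<lambda>n. (real n)\<^sup>2) at_top sequentially"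
    by real_asymp
  have "(\<lambda>n. real n / real n) \<longlonglongrightarrow> 1"
    by real_asymp
  from choose_3_limit[OF this filterlim_real_sequentially]
  have 1: "(\<lambda>n. real (n choose 3) / real n ^ 3) \<longlonglongrightarrow> 1 / 6"
    by simp
  have 2: "(\<lambda>n. real (m n choose 3) / vol n ^ 3) \<longlonglongrightarrow> (b / 2) ^ 3 / 6"
    by (rule choose_3_limit[OF m filterlim_vol])
  have 3: "(\<lambda>n. real (card (edge_slots n) choose 3) / ((real n)\<^sup>2) ^ 3) \<longlonglongrightarrow> (1 / 2) ^ 3 / 6"
    by (rule choose_3_limit[OF slots_over_square sq])
  have lim: "(\<lambda>n. real (n choose 3) / real n ^ 3 * (real (m n choose 3) / vol n ^ 3) /
      (real (card (edge_slots n) choose 3) / ((real n)\<^sup>2) ^ 3)) \<longlonglongrightarrow> 1 / 6 * ((b / 2) ^ 3 / 6) / ((1 / 2) ^ 3 / 6)"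
    by (intro tendsto_divide tendsto_mult 1 2 3) auto
  have val: "1 / 6 * ((b / 2) ^ 3 / 6) / ((1 / 2) ^ 3 / 6) = b ^ 3 / 6"
    by (simp add: power_divide)
  have "\<forall>\<^sub>F n in sequentially. 3 \<le> m n"
  proof -
    have "\<forall>\<^sub>F n in sequentially. b / 4 < real (m n) / vol n"
      using m by (rule order_tendstoD) (use b in auto)
    moreover have "\<forall>\<^sub>F n in sequentially. 12 / b \<le> vol n"
      using filterlim_vol by (auto simp: filterlim_at_top)
    ultimately show ?thesis
      using eventually_gt_at_top[of 0]
    proof eventually_elim
      case (elim n)
      have "3 \<le> b / 4 * vol n"
        using elim(2) b by (simp add: field_simps)
      also have "\<dots> \<le> real (m n)"
        using elim by (simp add: less_divide_eq)
      finally show ?case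
        by linarith
    qed
  qed
  then have "\<forall>\<^sub>F n in sequentially. real (n choose 3) / real n ^ 3 * (real (m n choose 3) / vol n ^ 3) /
      (real (card (edge_slots n) choose 3) / ((real n)\<^sup>2) ^ 3) =
      measure_pmf.expectation (random_graph n (m n)) (\<lambda>G. real (triangle_count n G)) / vol n"
    using eventually_le_slots[OF m] eventually_gt_at_top[of 0]
  proof eventually_elim
    case (elim n)
    have "(vol n)\<^sup>2 = real n powr 3"
      by (simp add: power2_eq_square flip: powr_add)
    then have v: "vol n * vol n = real n ^ 3"
      using elim by (simp add: power2_eq_square powr_numeral)
    \<comment> \<open>As \<open>vol n\<close> squared is \<open>n^3\<close>, the normalisations of
      the three cubics leave a single factor \<open>1 / vol n\<close>.\<close>
    have r: "((real n)\<^sup>2) ^ 3 / (real n ^ 3 * vol n ^ 3) = 1 / vol n"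
      using elim v by (simp add: power3_eq_cube power2_eq_square field_simps)
    have "x / real n ^ 3 * (y / vol n ^ 3) / (w / ((real n)\<^sup>2) ^ 3) = x * y / w * (1 / vol n)" for x y w
      unfolding r[symmetric] by simp
    then show ?case
      unfolding expectation_triangles[OF elim(2,1)] by simp
  qed
  from Lim_transform_eventually[OF lim this] show ?thesis
    unfolding val .
qed

section \<open>Comparison of the uniform model with the Gibbs measure\<close>

lemma gibbs_eq:
  "gibbs b z n G = (b / sqrt (real n)) ^ card G * exp (z * b\<^sup>2 * card G) * (1 - z) ^ triangle_count n G"
proof -
  have "activity b z / sqrt (real n) = b / sqrt (real n) * exp (z * b\<^sup>2)"
    by (simp add: activity_def)
  then show ?thesis
    unfolding gibbs_def by (simp only: power_mult_distrib exp_of_nat2_mult)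
qed

text \<open>Here \<open>b\<close> is slightly too large for \<open>m\<close>: typical graphs have at
  least \<open>m\<close> edges and few triangles, so they belong to the upper levels of the sparse
  graphs. Their Gibbs weight is at most \<open>exp (\<kappa> vol)\<close> times the pure edge
  weight, which bounds half of the partition function by the density at \<open>m\<close> times
  explicit factors.\<close>

lemma sparse_prob_lower:
  fixes \<eta> :: real
  assumes b: "0 < b" "2 * (1 - \<eta>) * b\<^sup>2 < 1" and \<eta>: "0 \<le> \<eta>" "\<eta> < 1" and \<delta>: "0 < \<delta>"
    and m: "\<forall>\<^sub>F n in sequentially. m n \<le> (b / 2 - \<delta>) * vol n"
    and x0: "\<And>n. 0 \<le> x n"
    and x: "0 < \<eta> \<Longrightarrow> \<forall>\<^sub>F n in sequentially. (\<eta> * b ^ 3 / 6 + \<delta>) * vol n \<le> x n"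
    and r: "r < (1 - \<eta>) * b ^ 3 / 3 - (1 - \<eta>) * b\<^sup>2 * (b / 2 + \<delta>) - ln \<eta> * (\<eta> * b ^ 3 / 6 - \<delta>)"
  shows "\<forall>\<^sub>F n in sequentially. 0 < level_density (edge_slots n) (sparse n (x n)) (m n) \<and>
    r < ln (level_density (edge_slots n) (sparse n (x n)) (m n)) / vol n"
proof -
  define z where "z = 1 - \<eta>"
  have z: "0 \<le> z" "z \<le> 1" "0 < z" "2 * z * b\<^sup>2 < 1" "1 - z = \<eta>"
    using \<eta> b by (auto simp: z_def)
  \<comment> \<open>The first summand uses the largest typical edge count, the second the smallest
    typical triangle count, since \<open>ln \<eta>\<close> is negative. For \<eta> = 0 the value
    \<open>ln 0 = 0\<close> removes the second summand.\<close>
  define \<kappa> where "\<kappa> = z * b\<^sup>2 * (b / 2 + \<delta>) + ln \<eta> * (\<eta> * b ^ 3 / 6 - \<delta>)"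
  define N where "N n = real (card (edge_slots n))" for n
  have "(\<lambda>n. ln (gibbs_total b z n) / vol n - ln 2 / vol n - \<kappa> - b * (N n / (sqrt (real n) * vol n)))
      \<longlonglongrightarrow> (b / 2 + z * b ^ 3 / 3) - 0 - \<kappa> - b * (1 / 2)"
    unfolding N_def using z b
    by (intro tendsto_intros log_partition_limit card_edge_slots_ratio
        tendsto_divide_0[OF tendsto_const] filterlim_at_top_imp_at_infinity filterlim_vol) auto
  then have "\<forall>\<^sub>F n in sequentially. r <
      ln (gibbs_total b z n) / vol n - ln 2 / vol n - \<kappa> - b * (N n / (sqrt (real n) * vol n))"
    by (rule order_tendstoD) (use r in \<open>simp add: \<kappa>_def z_def\<close>)
  moreover have "\<forall>\<^sub>F n in sequentially. 0 < \<eta> \<longrightarrow> (\<eta> * b ^ 3 / 6 + \<delta>) * vol n \<le> x n"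
    using x by (cases "0 < \<eta>") auto
  ultimately show ?thesis
    using m typical_mass[OF z(1,2) b(1) z(4) \<delta>] eventually_gt_at_top[of 0]
  proof eventually_elim
    case (elim n)
    let ?\<Omega> = "edge_slots n" and ?D = "sparse n (x n)" and ?l = "b / sqrt (real n)"
    let ?p = "level_density ?\<Omega> ?D (m n)"
    have vol: "0 < vol n"
      using elim by simp
    have l: "0 \<le> ?l"
      using b by simp
    \<comment> \<open>For \<eta> = 0 a typical graph may contain triangles, but then its weight is
      0; without triangles it is sparse because \<open>x n\<close> is nonnegative.\<close>
    have le: "gibbs b z n G \<le> (if G \<in> ?D \<and> m n \<le> card G then exp (\<kappa> * vol n) * ?l ^ card G else 0)"
      if G: "G \<in> typical b z \<delta> n" for G
    proof (cases "\<eta> = 0 \<and> triangle_count n G \<noteq> 0")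
      case True
      then have "gibbs b z n G = 0"
        using z by (simp add: gibbs_eq)
      then show ?thesis
        using l by simp
    next
      case False
      have sub: "G \<subseteq> ?\<Omega>" and cG: "(b / 2 - \<delta>) * vol n \<le> card G" "card G \<le> (b / 2 + \<delta>) * vol n"
        using G by (auto simp: typical_def abs_le_iff algebra_simps)
      have mG: "m n \<le> card G"
        using elim(3) cG by linarith
      have T: "triangle_count n G \<le> x n \<and>
        (1 - z) ^ triangle_count n G \<le> exp (ln \<eta> * (\<eta> * b ^ 3 / 6 - \<delta>) * vol n)"
      proof (cases "\<eta> = 0")
        case True
        then show ?thesis
          using False x0 z by simp
      next
        case \<eta>0: False
        then have t: "(\<eta> * b ^ 3 / 6 - \<delta>) * vol n \<le> triangle_count n G"
          "triangle_count n G \<le> (\<eta> * b ^ 3 / 6 + \<delta>) * vol n"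
          using G \<eta> z by (auto simp: typical_def abs_le_iff algebra_simps)
        have "(1 - z) ^ triangle_count n G = exp (ln \<eta> * triangle_count n G)"
          using \<eta>0 \<eta> z by (simp add: exp_of_nat2_mult)
        also have "\<dots> \<le> exp (ln \<eta> * ((\<eta> * b ^ 3 / 6 - \<delta>) * vol n))"
          using t(1) \<eta> \<eta>0 by (simp add: mult_left_mono_neg)
        finally show ?thesis
          using t(2) elim(2) \<eta>0 \<eta> by (auto simp: mult.assoc)
      qed
      have "gibbs b z n G \<le> ?l ^ card G * exp (z * b\<^sup>2 * ((b / 2 + \<delta>) * vol n)) *
          exp (ln \<eta> * (\<eta> * b ^ 3 / 6 - \<delta>) * vol n)"
        unfolding gibbs_eq using T cG z l \<eta>
        by (intro mult_mono mult_nonneg_nonneg mult_left_mono) (auto intro!: mult_left_mono)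
      also have "\<dots> = exp (\<kappa> * vol n) * ?l ^ card G"
      proof -
        have "\<kappa> * vol n = z * b\<^sup>2 * ((b / 2 + \<delta>) * vol n) + ln \<eta> * (\<eta> * b ^ 3 / 6 - \<delta>) * vol n"
          by (simp add: \<kappa>_def algebra_simps)
        then show ?thesis
          by (simp only: exp_add mult_ac)
      qed
      finally show ?thesis
        using T mG sub by (simp add: sparse_def)
    qed
    have "gibbs_total b z n / 2 \<le> (\<Sum>G\<in>typical b z \<delta> n. gibbs b z n G)"
      by (rule elim)
    also have "\<dots> \<le> (\<Sum>G\<in>typical b z \<delta> n. if G \<in> ?D \<and> m n \<le> card G then exp (\<kappa> * vol n) * ?l ^ card G else 0)"
      by (rule sum_mono) (rule le)
    also have "\<dots> \<le> (\<Sum>G\<in>Pow ?\<Omega>. if G \<in> ?D \<and> m n \<le> card G then exp (\<kappa> * vol n) * ?l ^ card G else 0)"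
      using l by (intro sum_mono2) (auto simp: typical_def)
    also have "\<dots> = exp (\<kappa> * vol n) * (\<Sum>G | G \<in> ?D \<and> m n \<le> card G. ?l ^ card G)"
    proof -
      have "{G \<in> Pow ?\<Omega>. G \<in> ?D \<and> m n \<le> card G} = {G. G \<in> ?D \<and> m n \<le> card G}"
        by (auto simp: sparse_def)
      then show ?thesis
        by (simp add: sum.inter_filter[symmetric] sum_distrib_left)
    qed
    also have "\<dots> \<le> exp (\<kappa> * vol n) * (?p * (1 + ?l) ^ card ?\<Omega>)"
      by (intro mult_left_mono upper_levels_le sparse_subset l) (auto intro: sparse_down)
    also have "\<dots> \<le> exp (\<kappa> * vol n) * (?p * exp (?l * N n))"
    proof -
      have "(1 + ?l) ^ card ?\<Omega> \<le> exp ?l ^ card ?\<Omega>"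
        using l by (intro power_mono exp_ge_add_one_self) auto
      also have "exp ?l ^ card ?\<Omega> = exp (?l * N n)"
        by (simp only: N_def exp_of_nat2_mult)
      finally show ?thesis
        by (intro mult_left_mono level_density_nonneg) simp_all
    qed
    finally have main: "gibbs_total b z n / 2 \<le> exp (\<kappa> * vol n) * (?p * exp (?l * N n))" .
    have Z: "0 < gibbs_total b z n"
      using gibbs_total_ge_one[of b z n] b z by simp
    have p: "0 < ?p"
    proof (rule ccontr)
      assume "\<not> 0 < ?p"
      then have "?p = 0"
        using level_density_nonneg[of ?\<Omega> ?D "m n"] by simp
      then show False
        using main Z by simp
    qed
    have "ln (gibbs_total b z n / 2) \<le> ln (exp (\<kappa> * vol n) * (?p * exp (?l * N n)))"
      using main Z p by (subst ln_le_cancel_iff) auto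
    then have "ln (gibbs_total b z n) - ln 2 \<le> \<kappa> * vol n + (ln ?p + ?l * N n)"
      using Z p by (simp add: ln_mult ln_div)
    then have "(ln (gibbs_total b z n) - ln 2 - \<kappa> * vol n - ?l * N n) / vol n \<le> ln ?p / vol n"
      using vol by (intro divide_right_mono) auto
    moreover have "(ln (gibbs_total b z n) - ln 2 - \<kappa> * vol n - ?l * N n) / vol n =
        ln (gibbs_total b z n) / vol n - ln 2 / vol n - \<kappa> - b * (N n / (sqrt (real n) * vol n))"
      using vol by (simp add: diff_divide_distrib)
    ultimately show ?case
      using elim(1) p by linarith
  qed
qed

text \<open>Here \<open>b\<close> is slightly too small for \<open>m\<close>. All graphs with at
  most \<open>m\<close> edges have, at the activity for \<open>z\<close>, a weight bounded below
  through the measure with \<open>z = 0\<close>. The sparse ones have \<open>(1 - z)^X\<close> at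
  least \<open>\<eta>^x\<close>, hence total weight at most \<open>\<eta>^(-x)\<close> times the
  partition function. A positive density is assumed because \<open>ln 0 = 0\<close>.\<close>

lemma sparse_prob_upper:
  fixes \<eta> :: real
  assumes b: "0 < b" "2 * (1 - \<eta>) * b\<^sup>2 < 1" and \<eta>: "0 \<le> \<eta>" "\<eta> < 1" and \<delta>: "0 < \<delta>"
    and m: "\<forall>\<^sub>F n in sequentially. (b / 2 + \<delta>) * vol n \<le> m n"
    and x: "(\<lambda>n. x n / vol n) \<longlonglongrightarrow> \<xi>" "\<eta> = 0 \<Longrightarrow> (\<And>n. x n = 0)"
    and p: "\<forall>\<^sub>F n in sequentially. 0 < level_density (edge_slots n) (sparse n (x n)) (m n)"
    and r: "(1 - \<eta>) * b ^ 3 / 3 - (1 - \<eta>) * b\<^sup>2 * (b / 2 - \<delta>) - ln \<eta> * \<xi> < r"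
  shows "\<forall>\<^sub>F n in sequentially. ln (level_density (edge_slots n) (sparse n (x n)) (m n)) / vol n < r"
proof -
  define z where "z = 1 - \<eta>"
  have z: "0 \<le> z" "z \<le> 1" "2 * z * b\<^sup>2 < 1" "1 - z = \<eta>"
    using \<eta> b by (auto simp: z_def)
  \<comment> \<open>The activity for \<open>z\<close> exceeds the one for 0 by
    \<open>exp (z b^2)\<close> per edge; \<kappa> collects this over the smallest typical edge
    count.\<close>
  define \<kappa> where "\<kappa> = z * b\<^sup>2 * (b / 2 - \<delta>)"
  have "(\<lambda>n. ln (gibbs_total b z n) / vol n - ln \<eta> * (x n / vol n) - \<kappa> - ln (gibbs_total b 0 n) / vol n + ln 2 / vol n)
      \<longlonglongrightarrow> (b / 2 + z * b ^ 3 / 3) - ln \<eta> * \<xi> - \<kappa> - (b / 2 + 0 * b ^ 3 / 3) + 0"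
    using z b
    by (intro tendsto_intros log_partition_limit x
        tendsto_divide_0[OF tendsto_const] filterlim_at_top_imp_at_infinity filterlim_vol) auto
  then have "\<forall>\<^sub>F n in sequentially. ln (gibbs_total b z n) / vol n - ln \<eta> * (x n / vol n) - \<kappa> -
      ln (gibbs_total b 0 n) / vol n + ln 2 / vol n < r"
    by (rule order_tendstoD) (use r in \<open>simp add: \<kappa>_def z_def\<close>)
  moreover have "\<forall>\<^sub>F n in sequentially. gibbs_total b 0 n / 2 \<le> (\<Sum>G\<in>typical b 0 \<delta> n. gibbs b 0 n G)"
    by (rule typical_mass) (use b \<delta> in auto)
  ultimately show ?thesis
    using m p eventually_gt_at_top[of 0]
  proof eventually_elim
    case (elim n)
    let ?\<Omega> = "edge_slots n" and ?D = "sparse n (x n)" and ?l = "activity b z / sqrt (real n)"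
    let ?p = "level_density ?\<Omega> ?D (m n)"
    have vol: "0 < vol n"
      using elim by simp
    have l: "0 \<le> ?l"
      using b by (simp add: activity_nonneg)
    have bound: "exp (\<kappa> * vol n) * gibbs b 0 n G \<le> ?l ^ card G \<and> G \<subseteq> ?\<Omega> \<and> card G \<le> m n"
      if G: "G \<in> typical b 0 \<delta> n" for G
    proof -
      have sub: "G \<subseteq> ?\<Omega>" and cG: "(b / 2 - \<delta>) * vol n \<le> card G" "card G \<le> (b / 2 + \<delta>) * vol n"
        using G by (auto simp: typical_def abs_le_iff algebra_simps)
      have "\<kappa> * vol n \<le> z * b\<^sup>2 * card G"
        unfolding \<kappa>_def mult.assoc[of "z * b\<^sup>2"] using cG z by (intro mult_left_mono) auto
      then have "exp (\<kappa> * vol n) * (b / sqrt (real n)) ^ card G \<le>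
          exp (z * b\<^sup>2 * card G) * (b / sqrt (real n)) ^ card G"
        using b by (intro mult_right_mono) auto
      also have "\<dots> = ?l ^ card G"
        by (simp add: activity_def power_mult_distrib power_divide exp_of_nat2_mult)
      finally show ?thesis
        using sub cG elim(3) by (simp add: gibbs_eq)
    qed
    have "?p * (exp (\<kappa> * vol n) * (gibbs_total b 0 n / 2)) \<le>
        ?p * (exp (\<kappa> * vol n) * (\<Sum>G\<in>typical b 0 \<delta> n. gibbs b 0 n G))"
      using elim by (intro mult_left_mono) auto
    also have "\<dots> \<le> ?p * (\<Sum>G\<in>typical b 0 \<delta> n. ?l ^ card G)"
      using bound by (auto simp: sum_distrib_left[of "exp (\<kappa> * vol n)"]
          intro!: mult_left_mono sum_mono level_density_nonneg)
    also have "\<dots> \<le> ?p * (\<Sum>G | G \<subseteq> ?\<Omega> \<and> card G \<le> m n. ?l ^ card G)"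
      using bound l by (intro mult_left_mono sum_mono2 level_density_nonneg) auto
    also have "\<dots> \<le> (\<Sum>G\<in>?D. ?l ^ card G)"
      by (intro lower_levels_ge sparse_subset l) (auto intro: sparse_down)
    also have "\<dots> \<le> (\<Sum>G\<in>?D. exp (- ln \<eta> * x n) * gibbs b z n G)"
    proof (rule sum_mono)
      fix G assume G: "G \<in> ?D"
      \<comment> \<open>For \<eta> = 0 also \<open>x n = 0\<close>, so a sparse graph has no
        triangle and both sides are 1.\<close>
      have "exp (ln \<eta> * x n) \<le> \<eta> ^ triangle_count n G"
      proof (cases "\<eta> = 0")
        case True
        then show ?thesis
          using G x(2) by (simp add: sparse_def)
      next
        case False
        then have "exp (ln \<eta> * x n) \<le> exp (ln \<eta> * triangle_count n G)"
          using G \<eta> by (simp add: sparse_def mult_left_mono_neg)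
        also have "\<dots> = \<eta> ^ triangle_count n G"
          using False \<eta> by (simp add: exp_of_nat2_mult)
        finally show ?thesis .
      qed
      then have "exp (- ln \<eta> * x n) * (?l ^ card G * exp (ln \<eta> * x n)) \<le>
          exp (- ln \<eta> * x n) * (?l ^ card G * \<eta> ^ triangle_count n G)"
        using l by (intro mult_left_mono) auto
      moreover have "exp (- ln \<eta> * x n) * (?l ^ card G * exp (ln \<eta> * x n)) = ?l ^ card G"
        by (simp add: exp_minus)
      ultimately show "?l ^ card G \<le> exp (- ln \<eta> * x n) * gibbs b z n G"
        unfolding gibbs_def z(4) by (simp only:)
    qed
    also have "\<dots> \<le> exp (- ln \<eta> * x n) * gibbs_total b z n"
      unfolding sum_distrib_left[symmetric] gibbs_total_sum using b z sparse_subset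
      by (intro mult_left_mono sum_mono2 gibbs_nonneg) auto
    finally have main: "?p * (exp (\<kappa> * vol n) * (gibbs_total b 0 n / 2)) \<le> exp (- ln \<eta> * x n) * gibbs_total b z n" .
    have Z: "0 < gibbs_total b z n" "0 < gibbs_total b 0 n"
      using gibbs_total_ge_one[of b z n] gibbs_total_ge_one[of b 0 n] b z by auto
    have "ln (?p * (exp (\<kappa> * vol n) * (gibbs_total b 0 n / 2))) \<le> ln (exp (- ln \<eta> * x n) * gibbs_total b z n)"
      using main Z elim(4) by (subst ln_le_cancel_iff) auto
    then have "ln ?p + (\<kappa> * vol n + (ln (gibbs_total b 0 n) - ln 2)) \<le> - ln \<eta> * x n + ln (gibbs_total b z n)"
      using Z elim(4) by (simp add: ln_mult ln_div)
    then have "ln ?p / vol n \<le> (ln (gibbs_total b z n) - ln \<eta> * x n - \<kappa> * vol n - ln (gibbs_total b 0 n) + ln 2) / vol n"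
      using vol by (intro divide_right_mono) auto
    also have "\<dots> = ln (gibbs_total b z n) / vol n - ln \<eta> * (x n / vol n) - \<kappa> - ln (gibbs_total b 0 n) / vol n + ln 2 / vol n"
      using vol by (simp add: diff_divide_distrib add_divide_distrib)
    finally show ?case
      using elim(1) by linarith
  qed
qed

text \<open>A value above 1 would force \<open>e <= 2 / e\<close>, contradicting
  \<open>e >= 2\<close>. The bound turns the hypothesis on \<open>b\<close> into the contraction
  condition at \<open>z = 1 - \<eta>\<close>.\<close>

lemma lambert_W_two_over_e: "lambert_W (2 / exp 1) \<le> 1"
proof -
  have "(2 / exp 1 :: real) \<in> (\<lambda>x. x * exp x) ` {0..}"
    unfolding bij_betw_imp_surj_on[OF bij_betw_times_exp] by simp
  then obtain w :: real where w: "0 \<le> w" "w * exp w = 2 / exp 1"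
    by (metis (no_types, lifting) atLeast_iff imageE)
  have W: "lambert_W (2 / exp 1) = w"
    unfolding lambert_W_def w(2)[symmetric]
    using w(1) bij_betw_times_exp by (intro the_inv_into_f_f) (auto simp: bij_betw_def)
  have e: "2 \<le> exp (1::real)"
    using exp_ge_add_one_self[of 1] by simp
  have "w \<le> 1"
  proof (rule ccontr)
    assume "\<not> w \<le> 1"
    then have "1 * exp 1 \<le> w * exp w"
      by (intro mult_mono) auto
    then have "exp 1 * exp 1 \<le> (2::real)"
      using w(2) by (simp add: field_simps)
    moreover have "2 * 2 \<le> exp 1 * exp (1::real)"
      by (intro mult_mono e) auto
    ultimately show False
      by simp
  qed
  then show ?thesis
    by (simp add: W)
qed

text \<open>The lower-tail exponent of a Poisson variable with mean \<open>b ^ 3 / 6\<close> times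
  the scale, at the fraction \<eta> of its mean.\<close>

definition poisson_rate :: "real \<Rightarrow> real \<Rightarrow> real" where
  "poisson_rate b \<eta> = - (b ^ 3 / 6) * (1 - \<eta> + \<eta> * ln \<eta>)"

context
  fixes b \<eta> :: real and m :: "nat \<Rightarrow> nat" and x :: "nat \<Rightarrow> real"
  assumes b: "0 < b" and \<eta>: "0 \<le> \<eta>" "\<eta> < 1" and small: "2 * (1 - \<eta>) * b\<^sup>2 < 1"
    and m: "(\<lambda>n. real (m n) / vol n) \<longlonglongrightarrow> b / 2"
    and x: "(\<lambda>n. x n / vol n) \<longlonglongrightarrow> \<eta> * b ^ 3 / 6"
    and x_nonneg: "\<And>n. 0 \<le> x n" and x_zero: "\<eta> = 0 \<Longrightarrow> (\<And>n. x n = 0)"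
begin

lemma sparse_rate_lower:
  assumes r: "r < poisson_rate b \<eta>"
  shows "\<forall>\<^sub>F n in sequentially. 0 < level_density (edge_slots n) (sparse n (x n)) (m n) \<and>
    r < ln (level_density (edge_slots n) (sparse n (x n)) (m n)) / vol n"
proof -
  \<comment> \<open>Aiming at a slightly smaller fraction \<eta>' leaves room for fluctuations of
    the triangle count below \<open>x n\<close>. For \<eta> = 0 there is no room below, and \<eta>'
    = 0 is used, where no triangle is allowed at all.\<close>
  have "\<exists>\<eta>'. 0 \<le> \<eta>' \<and> \<eta>' < 1 \<and> (0 < \<eta>' \<longrightarrow> \<eta>' < \<eta>) \<and> 2 * (1 - \<eta>') * b\<^sup>2 < 1 \<and> r < poisson_rate b \<eta>'"
  proof (cases "\<eta> = 0")
    case True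
    then show ?thesis
      using small r by (intro exI[of _ 0]) auto
  next
    case False
    have "((\<lambda>t. 2 * (1 - t) * b\<^sup>2) \<longlongrightarrow> 2 * (1 - \<eta>) * b\<^sup>2) (at_left \<eta>)"
      by (intro tendsto_intros)
    then have "\<forall>\<^sub>F t in at_left \<eta>. 2 * (1 - t) * b\<^sup>2 < 1"
      using small by (rule order_tendstoD)
    moreover have "((\<lambda>t. poisson_rate b t) \<longlongrightarrow> poisson_rate b \<eta>) (at_left \<eta>)"
      unfolding poisson_rate_def using False by (intro tendsto_intros) auto
    then have "\<forall>\<^sub>F t in at_left \<eta>. r < poisson_rate b t"
      using r by (rule order_tendstoD)
    moreover have "\<forall>\<^sub>F t in at_left \<eta>. t \<in> {0<..<\<eta>}"
      using False \<eta> by (intro eventually_at_left_real) auto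
    ultimately have "\<forall>\<^sub>F t in at_left \<eta>. 0 \<le> t \<and> t < 1 \<and> (0 < t \<longrightarrow> t < \<eta>) \<and>
        2 * (1 - t) * b\<^sup>2 < 1 \<and> r < poisson_rate b t"
      by eventually_elim (use \<eta> in auto)
    then show ?thesis
      using eventually_happens'[OF trivial_limit_at_left_real] by blast
  qed
  then obtain \<eta>' where \<eta>': "0 \<le> \<eta>'" "\<eta>' < 1" "0 < \<eta>' \<Longrightarrow> \<eta>' < \<eta>" "2 * (1 - \<eta>') * b\<^sup>2 < 1"
    "r < poisson_rate b \<eta>'"
    by blast
  \<comment> \<open>With density \<open>b + 4 t\<close> and window \<open>t\<close>, even the lowest
    typical edge count is about \<open>b / 2 + t\<close>, which exceeds \<open>m\<close> by a
    margin.\<close>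
  define R where "R t = (1 - \<eta>') * (b + 4 * t) ^ 3 / 3 - (1 - \<eta>') * (b + 4 * t)\<^sup>2 * ((b + 4 * t) / 2 + t) -
    ln \<eta>' * (\<eta>' * (b + 4 * t) ^ 3 / 6 - t)" for t
  have "(R \<longlongrightarrow> R 0) (at_right 0)"
    unfolding R_def by (intro tendsto_intros) auto
  moreover have "R 0 = poisson_rate b \<eta>'"
    by (simp add: R_def poisson_rate_def field_simps power2_eq_square power3_eq_cube)
  ultimately have "\<forall>\<^sub>F t in at_right 0. r < R t"
    using \<eta>'(5) by (intro order_tendstoD) auto
  moreover have "((\<lambda>t. 2 * (1 - \<eta>') * (b + 4 * t)\<^sup>2) \<longlongrightarrow> 2 * (1 - \<eta>') * (b + 4 * 0)\<^sup>2) (at_right 0)"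
    by (intro tendsto_intros)
  then have "\<forall>\<^sub>F t in at_right 0. 2 * (1 - \<eta>') * (b + 4 * t)\<^sup>2 < 1"
    by (rule order_tendstoD) (use \<eta>' in simp)
  moreover have "\<forall>\<^sub>F t in at_right 0. 0 < \<eta>' \<longrightarrow> \<eta>' * (b + 4 * t) ^ 3 / 6 + t < \<eta> * b ^ 3 / 6"
  proof (cases "0 < \<eta>'")
    case True
    have "((\<lambda>t. \<eta>' * (b + 4 * t) ^ 3 / 6 + t) \<longlongrightarrow> \<eta>' * (b + 4 * 0) ^ 3 / 6 + 0) (at_right 0)"
      by (intro tendsto_intros) auto
    then have "\<forall>\<^sub>F t in at_right 0. \<eta>' * (b + 4 * t) ^ 3 / 6 + t < \<eta> * b ^ 3 / 6"
      by (rule order_tendstoD) (use \<eta>'(3)[OF True] b in simp)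
    then show ?thesis
      by eventually_elim simp
  qed simp
  moreover have "\<forall>\<^sub>F t in at_right 0. (0::real) < t"
    by (rule eventually_at_right_less)
  ultimately have "\<forall>\<^sub>F t in at_right 0. r < R t \<and> 2 * (1 - \<eta>') * (b + 4 * t)\<^sup>2 < 1 \<and>
      (0 < \<eta>' \<longrightarrow> \<eta>' * (b + 4 * t) ^ 3 / 6 + t < \<eta> * b ^ 3 / 6) \<and> 0 < t"
    by eventually_elim blast
  then obtain t where t: "r < R t" "2 * (1 - \<eta>') * (b + 4 * t)\<^sup>2 < 1"
      "0 < \<eta>' \<Longrightarrow> \<eta>' * (b + 4 * t) ^ 3 / 6 + t < \<eta> * b ^ 3 / 6" "0 < t"
    using eventually_happens'[OF trivial_limit_at_right_real] by blast
  show ?thesis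
  proof (rule sparse_prob_lower[of "b + 4 * t" \<eta>' t])
    have "\<forall>\<^sub>F n in sequentially. real (m n) / vol n < (b + 4 * t) / 2 - t"
      using m by (rule order_tendstoD) (use t in \<open>simp add: field_simps\<close>)
    then show "\<forall>\<^sub>F n in sequentially. real (m n) \<le> ((b + 4 * t) / 2 - t) * vol n"
      using eventually_gt_at_top[of 0]
    proof eventually_elim
      case (elim n)
      then have "real (m n) < ((b + 4 * t) / 2 - t) * vol n"
        by (subst (asm) pos_divide_less_eq) auto
      then show ?case
        by simp
    qed
  next
    assume "0 < \<eta>'"
    from order_tendstoD(1)[OF x t(3)[OF this]]
    show "\<forall>\<^sub>F n in sequentially. (\<eta>' * (b + 4 * t) ^ 3 / 6 + t) * vol n \<le> x n"
      using eventually_gt_at_top[of 0]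
    proof eventually_elim
      case (elim n)
      then have "(\<eta>' * (b + 4 * t) ^ 3 / 6 + t) * vol n < x n"
        by (subst (asm) pos_less_divide_eq) auto
      then show ?case
        by simp
    qed
  qed (use b \<eta>' t x_nonneg in \<open>auto simp: R_def\<close>)
qed

lemma sparse_rate_upper:
  assumes r: "poisson_rate b \<eta> < r"
    and p: "\<forall>\<^sub>F n in sequentially. 0 < level_density (edge_slots n) (sparse n (x n)) (m n)"
  shows "\<forall>\<^sub>F n in sequentially. ln (level_density (edge_slots n) (sparse n (x n)) (m n)) / vol n < r"
proof -
  \<comment> \<open>With density \<open>b - 4 t\<close> the highest typical edge count is about
    \<open>b / 2 - t\<close>, below \<open>m\<close>. Here \<eta> needs no shift, since only the
    limit of \<open>x n / vol n\<close> enters.\<close>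
  define R where "R t = (1 - \<eta>) * (b - 4 * t) ^ 3 / 3 - (1 - \<eta>) * (b - 4 * t)\<^sup>2 * ((b - 4 * t) / 2 - t) -
    ln \<eta> * (\<eta> * b ^ 3 / 6)" for t
  have "(R \<longlongrightarrow> R 0) (at_right 0)"
    unfolding R_def by (intro tendsto_intros) auto
  moreover have "R 0 = poisson_rate b \<eta>"
    by (simp add: R_def poisson_rate_def field_simps power2_eq_square power3_eq_cube)
  ultimately have "\<forall>\<^sub>F t in at_right 0. R t < r"
    using r by (intro order_tendstoD(2)) auto
  moreover have "((\<lambda>t. 2 * (1 - \<eta>) * (b - 4 * t)\<^sup>2) \<longlongrightarrow> 2 * (1 - \<eta>) * (b - 4 * 0)\<^sup>2) (at_right 0)"
    by (intro tendsto_intros)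
  then have "\<forall>\<^sub>F t in at_right 0. 2 * (1 - \<eta>) * (b - 4 * t)\<^sup>2 < 1"
    by (rule order_tendstoD) (use small in simp)
  moreover have "\<forall>\<^sub>F t in at_right 0. t \<in> {0<..<b / 4}"
    using b by (intro eventually_at_right_real) auto
  ultimately have "\<forall>\<^sub>F t in at_right 0. R t < r \<and> 2 * (1 - \<eta>) * (b - 4 * t)\<^sup>2 < 1 \<and> t \<in> {0<..<b / 4}"
    by eventually_elim blast
  then obtain t where t: "R t < r" "2 * (1 - \<eta>) * (b - 4 * t)\<^sup>2 < 1" "t \<in> {0<..<b / 4}"
    using eventually_happens'[OF trivial_limit_at_right_real] by blast
  show ?thesis
  proof (rule sparse_prob_upper[of "b - 4 * t" \<eta> t m x "\<eta> * b ^ 3 / 6"])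
    have "\<forall>\<^sub>F n in sequentially. (b - 4 * t) / 2 + t < real (m n) / vol n"
      using m by (rule order_tendstoD) (use t in \<open>simp add: field_simps\<close>)
    then show "\<forall>\<^sub>F n in sequentially. ((b - 4 * t) / 2 + t) * vol n \<le> real (m n)"
      using eventually_gt_at_top[of 0]
    proof eventually_elim
      case (elim n)
      then have "((b - 4 * t) / 2 + t) * vol n < real (m n)"
        by (subst (asm) pos_less_divide_eq) auto
      then show ?case
        by simp
    qed
  qed (use b \<eta> t x x_zero p in \<open>auto simp: R_def\<close>)
qed

end

theorem theorem1p8:
  fixes b \<eta> :: real and m :: "nat \<Rightarrow> nat"
  assumes "b > 0" and "0 \<le> \<eta>" and "\<eta> < 1"
    and "b\<^sup>2 * (1 - \<eta>) < 1 / 2 * lambert_W (2 / exp 1)"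
    and "(\<lambda>n. real (m n)) \<sim>[at_top] (\<lambda>n. b / 2 * real n powr (3 / 2))"
  shows "(\<lambda>n. 1 / real n powr (3 / 2) *
            ln (measure_pmf.prob (random_graph n (m n))
                 {G. real (triangle_count n G)
                       \<le> \<eta> * measure_pmf.expectation (random_graph n (m n))
                              (\<lambda>H. real (triangle_count n H))}))
         \<longlonglongrightarrow> - (b ^ 3 / 6) * (1 - \<eta> + \<eta> * ln \<eta>)"
proof -
  define x where "x n = \<eta> * measure_pmf.expectation (random_graph n (m n)) (\<lambda>H. real (triangle_count n H))" for n
  define p where "p n = level_density (edge_slots n) (sparse n (x n)) (m n)" for n
  have small: "2 * (1 - \<eta>) * b\<^sup>2 < 1"
    using assms(4) lambert_W_two_over_e by (simp add: algebra_simps)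
  have m: "(\<lambda>n. real (m n) / vol n) \<longlonglongrightarrow> b / 2"
  proof -
    have "(\<lambda>n. b / 2 * (real (m n) / (b / 2 * vol n))) \<longlonglongrightarrow> b / 2 * 1"
      using assms(1) by (intro tendsto_mult tendsto_const asymp_equivD_strong[OF assms(5)]
          eventually_mono[OF eventually_gt_at_top[of 0]]) auto
    then show ?thesis
      using assms(1) by simp
  qed
  have x: "(\<lambda>n. x n / vol n) \<longlonglongrightarrow> \<eta> * b ^ 3 / 6"
    using tendsto_mult[OF tendsto_const expectation_limit[OF assms(1) m], of \<eta>] by (simp add: x_def)
  have x_nonneg: "0 \<le> x n" for n
    using assms(2) by (simp add: x_def)
  have x_zero: "x n = 0" if "\<eta> = 0" for n
    using that by (simp add: x_def)
  have lower: "\<forall>\<^sub>F n in sequentially. 0 < p n \<and> r < ln (p n) / vol n" if "r < poisson_rate b \<eta>" for r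
    unfolding p_def
    by (rule sparse_rate_lower[OF assms(1-3) small m x x_nonneg]) (use x_zero that in auto)
  \<comment> \<open>Positivity, a premise of the upper bound, comes from the lower bound with an
    arbitrary number below the rate.\<close>
  have "\<forall>\<^sub>F n in sequentially. 0 < p n"
    using lower[of "poisson_rate b \<eta> - 1"] by (auto elim: eventually_mono)
  then have upper: "\<forall>\<^sub>F n in sequentially. ln (p n) / vol n < r" if "poisson_rate b \<eta> < r" for r
    unfolding p_def
    by (intro sparse_rate_upper[OF assms(1-3) small m x x_nonneg]) (use x_zero that in auto)
  have "(\<lambda>n. ln (p n) / vol n) \<longlonglongrightarrow> poisson_rate b \<eta>"
  proof (rule order_tendstoI)
    show "\<forall>\<^sub>F n in sequentially. r < ln (p n) / vol n" if "r < poisson_rate b \<eta>" for r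
      using lower[OF that] by (rule eventually_mono) blast
  qed (rule upper)
  moreover have "\<forall>\<^sub>F n in sequentially. ln (p n) / vol n = 1 / vol n * ln (measure_pmf.prob (random_graph n (m n))
                 {G. real (triangle_count n G) \<le> x n})"
    using eventually_le_slots[OF m] by eventually_elim (simp add: p_def prob_sparse)
  ultimately have "(\<lambda>n. 1 / vol n * ln (measure_pmf.prob (random_graph n (m n))
                 {G. real (triangle_count n G) \<le> x n})) \<longlonglongrightarrow> poisson_rate b \<eta>"
    by (rule Lim_transform_eventually)
  then show ?thesis
    by (simp only: x_def poisson_rate_def)
qed

end
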